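(* The maximal operator $\mathcal{M}_k$ is bounded on $BMO(\mathcal{L}_k)$; that is, there exists a constant $C>0$ such that for every $f\in BMO(\mathcal{L}_k)$ one has $\mathcal{M}_kf\in BMO(\mathcal{L}_k)$ and $\|\mathcal{M}_kf\|_{BMO(\mathcal{L}_k)}\le C\|f\|_{BMO(\mathcal{L}_k)}$.
   Context: Setting. Let $\mathcal{R}\subset\mathbb{R}^n\setminus\{0\}$ be a normalized root system: a finite set with $|\zeta|^2=2$, $\sigma_\zeta(\mathcal{R})=\mathcal{R}$ and $\mathcal{R}\cap\mathbb{R}\zeta=\{\pm\zeta\}$ for all $\zeta\in\mathcal{R}$, where $\sigma_\zeta(x)=x-2\frac{\langle x,\zeta\rangle}{|\zeta|^2}\zeta$. Let $G$ be the finite group generated by the $\sigma_\zeta$, and $\mathcal{R}_+=\{\zeta\in\mathcal{R}:\langle\zeta,b\rangle>0\}$ for a fixed $b$ orthogonal to no root. Let $k:\mathcal{R}\to[0,\infty)$ be $G$-invariant, $\gamma=\sum_{\zeta\in\mathcal{R}_+}k(\zeta)$, $w_k(x)=\prod_{\zeta\in\mathcal{R}_+}|\langle\zeta,x\rangle|^{2k(\zeta)}$, and $\omega_k(A)=\int_A w_k(x)\,dx$. $B(x,r)$ is the Euclidean ball with center $x$ and radius $r$. $L^1_{k,\mathrm{loc}}(\mathbb{R}^n)$ is the space of functions locally integrable with respect to $w_k(x)\,dx$. Potential. $V\ge 0$, $V\not\equiv 0$, belongs to the reverse Hölder class $RH_k^q(\mathbb{R}^n)$ with $q>\max\{1,\frac{n+2\gamma}{2}\}$: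 $V\in L^1_{k,\mathrm{loc}}(\mathbb{R}^n)$ and there is $C_{RH}>0$ with $\left(\frac{1}{\omega_k(B)}\int_B V^q w_k\,dx\right)^{1/q}\le \frac{C_{RH}}{\omega_k(B)}\int_B V w_k\,dx$ for every ball $B$. The critical radius function is $\rho_k(x)=\sup\{r>0:\ \frac{r^2}{\omega_k(B(x,r))}\int_{B(x,r)}V(\xi)w_k(\xi)\,d\xi\le 1\}$; one has $0<\rho_k(x)<\infty$. The space $BMO(\mathcal{L}_k)$. Put $f_B=\frac{1}{\omega_k(B)}\int_B f(x)w_k(x)\,dx$. A function $f\in L^1_{k,\mathrm{loc}}(\mathbb{R}^n)$ is in $BMO(\mathcal{L}_k)$ if there is $C_f\ge 0$ such that $\frac{1}{\omega_k(B(x,s))}\int_{B(x,s)}|f(y)-f_{B(x,s)}|w_k(y)\,dy\le C_f$ and $\frac{1}{\omega_k(B(x,r))}\int_{B(x,r)}|f(y)|w_k(y)\,dy\le C_f$ for all $x\in\mathbb{R}^n$ and all $s<\rho_k(x)\le r$. The smallest such $C_f$ is denoted $\|f\|_{BMO(\mathcal{L}_k)}$. Maximal operator. For $f\in L^1_{k,\mathrm{loc}}(\mathbb{R}^n)$, $\mathcal{M}_kf(x)=\sup_{B\ni x}\frac{1}{\omega_k(B)}\int_B|f(y)|w_k(y)\,dy$, the supremum being over all Euclidean balls $B$ containing $x$ (uncentered). *)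

theory Defs
  imports "HOL-Analysis.Analysis"
begin

section \<open>Root systems and the Dunkl measure\<close>

definition reflection :: "'a::euclidean_space \<Rightarrow> 'a \<Rightarrow> 'a" where
  "reflection \<zeta> x = x - (2 * (x \<bullet> \<zeta>) / (norm \<zeta>)\<^sup>2) *\<^sub>R \<zeta>"

definition normalized_root_system :: "'a::euclidean_space set \<Rightarrow> bool" where
  "normalized_root_system R \<longleftrightarrow> finite R \<and> 0 \<notin> R \<and>
     (\<forall>\<zeta>\<in>R. (norm \<zeta>)\<^sup>2 = 2 \<and> reflection \<zeta> ` R = R \<and> R \<inter> span {\<zeta>} = {\<zeta>, - \<zeta>})"

inductive_set reflection_group :: "'a::euclidean_space set \<Rightarrow> ('a \<Rightarrow> 'a) set"
  for R :: "'a set" where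
  one: "id \<in> reflection_group R"
| gen: "\<zeta> \<in> R \<Longrightarrow> reflection \<zeta> \<in> reflection_group R"
| mult: "g \<in> reflection_group R \<Longrightarrow> h \<in> reflection_group R \<Longrightarrow> g \<circ> h \<in> reflection_group R"
| inverse: "g \<in> reflection_group R \<Longrightarrow> inv g \<in> reflection_group R"

definition multiplicity_function :: "'a::euclidean_space set \<Rightarrow> ('a \<Rightarrow> real) \<Rightarrow> bool" where
  "multiplicity_function R k \<longleftrightarrow>
     (\<forall>\<zeta>\<in>R. 0 \<le> k \<zeta>) \<and> (\<forall>g\<in>reflection_group R. \<forall>\<zeta>\<in>R. k (g \<zeta>) = k \<zeta>)"

definition positive_roots :: "'a::euclidean_space set \<Rightarrow> 'a \<Rightarrow> 'a set" where
  "positive_roots R b = {\<zeta>\<in>R. 0 < \<zeta> \<bullet> b}"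

definition gamma_index :: "'a::euclidean_space set \<Rightarrow> 'a \<Rightarrow> ('a \<Rightarrow> real) \<Rightarrow> real" where
  "gamma_index R b k = (\<Sum>\<zeta>\<in>positive_roots R b. k \<zeta>)"

text \<open>The case distinction is needed because \<open>0 powr 0 = 0\<close>, whereas a root with
  \<open>k \<zeta> = 0\<close> must contribute the factor 1 everywhere.\<close>

definition dunkl_weight :: "'a::euclidean_space set \<Rightarrow> 'a \<Rightarrow> ('a \<Rightarrow> real) \<Rightarrow> 'a \<Rightarrow> real" where
  "dunkl_weight R b k x =
     (\<Prod>\<zeta>\<in>positive_roots R b. if k \<zeta> = 0 then 1 else \<bar>\<zeta> \<bullet> x\<bar> powr (2 * k \<zeta>))"

text \<open>The density is taken over \<open>lebesgue\<close>, not \<open>lborel\<close>, so that all Lebesgue measurable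
  functions (not only Borel ones) can be integrable. Integrals with respect to this measure
  are the integrals against \<open>w\<^sub>k(x) dx\<close>.\<close>

definition dunkl_measure :: "'a::euclidean_space set \<Rightarrow> 'a \<Rightarrow> ('a \<Rightarrow> real) \<Rightarrow> 'a measure" where
  "dunkl_measure R b k = density lebesgue (\<lambda>x. ennreal (dunkl_weight R b k x))"

section \<open>Averages, local integrability, and the uncentered maximal operator\<close>

definition locally_integrable ::
  "'a::euclidean_space measure \<Rightarrow> ('a \<Rightarrow> 'b::{banach, second_countable_topology}) \<Rightarrow> bool" where
  "locally_integrable \<mu> f \<longleftrightarrow> (\<forall>K. compact K \<longrightarrow> set_integrable \<mu> K f)"

definition mean ::
  "'a measure \<Rightarrow> 'a set \<Rightarrow> ('a \<Rightarrow> 'b::{banach, second_countable_topology}) \<Rightarrow> 'b" where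
  "mean \<mu> B f = (LINT x:B|\<mu>. f x) /\<^sub>R measure \<mu> B"

text \<open>The supremum may be infinite at some points, hence the values in \<open>[0,\<infinity>]\<close>.\<close>

definition maximal_function ::
  "'a::euclidean_space measure \<Rightarrow> ('a \<Rightarrow> 'b::{banach, second_countable_topology}) \<Rightarrow> 'a \<Rightarrow> ennreal"
where
  "maximal_function \<mu> f x =
     (SUP (c, r) \<in> {(c, r). 0 < r \<and> x \<in> ball c r}. ennreal (mean \<mu> (ball c r) (\<lambda>y. norm (f y))))"

section \<open>The potential and the critical radius\<close>

text \<open>Integrability of \<open>V\<^sup>q\<close> on balls is implicit in the reverse Hoelder inequality (its
  right-hand side is finite); it has to be spelled out because the Bochner integral of a
  non-integrable function is 0.\<close>

definition reverse_Hoelder :: "'a::euclidean_space measure \<Rightarrow> real \<Rightarrow> ('a \<Rightarrow> real) \<Rightarrow> bool" where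
  "reverse_Hoelder \<mu> q V \<longleftrightarrow> locally_integrable \<mu> V \<and>
     (\<exists>C>0. \<forall>x r. 0 < r \<longrightarrow>
        set_integrable \<mu> (ball x r) (\<lambda>y. V y powr q) \<and>
        mean \<mu> (ball x r) (\<lambda>y. V y powr q) powr (1 / q) \<le> C * mean \<mu> (ball x r) V)"

definition critical_radius :: "'a::euclidean_space measure \<Rightarrow> ('a \<Rightarrow> real) \<Rightarrow> 'a \<Rightarrow> real" where
  "critical_radius \<mu> V x = Sup {r. 0 < r \<and> r\<^sup>2 * mean \<mu> (ball x r) V \<le> 1}"

section \<open>The space BMO associated with the Schroedinger operator\<close>

definition BMO_bound ::
  "'a::euclidean_space measure \<Rightarrow> ('a \<Rightarrow> real) \<Rightarrow> ('a \<Rightarrow> 'b::{banach, second_countable_topology})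
     \<Rightarrow> real \<Rightarrow> bool" where
  "BMO_bound \<mu> V f C \<longleftrightarrow> 0 \<le> C \<and>
     (\<forall>x s r. 0 < s \<and> s < critical_radius \<mu> V x \<and> critical_radius \<mu> V x \<le> r \<longrightarrow>
        mean \<mu> (ball x s) (\<lambda>y. norm (f y - mean \<mu> (ball x s) f)) \<le> C \<and>
        mean \<mu> (ball x r) (\<lambda>y. norm (f y)) \<le> C)"

definition BMO ::
  "'a::euclidean_space measure \<Rightarrow> ('a \<Rightarrow> real) \<Rightarrow> ('a \<Rightarrow> 'b::{banach, second_countable_topology}) set"
where
  "BMO \<mu> V = {f. locally_integrable \<mu> f \<and> (\<exists>C. BMO_bound \<mu> V f C)}"

definition BMO_norm ::
  "'a::euclidean_space measure \<Rightarrow> ('a \<Rightarrow> real) \<Rightarrow> ('a \<Rightarrow> 'b::{banach, second_countable_topology})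
     \<Rightarrow> real" where
  "BMO_norm \<mu> V f = Inf {C. BMO_bound \<mu> V f C}"

end

theory Submission
  imports Defs
begin

text \<open>The maximal function estimate is a fact about doubling measures, and the Dunkl measure is doubling
  for Euclidean balls (lemma \<open>dunkl_measure_growth\<close>). The potential has to ensure that the critical
  radius is positive (lemma \<open>critical_radius_pos\<close>), so that the definition of BMO constrains \<open>f\<close> around
  every point: the reverse Hoelder inequality with exponent above half of the
  homogeneous dimension makes \<open>r\<^sup>2\<close> times the mean of \<open>V\<close> grow like a power of \<open>r\<close>.

  For \<open>f\<close> in BMO put \<open>g = norm f\<close>. Balls of radius below the critical radius have small
  oscillation by definition, and the others have small mean, so \<open>g\<close> has oscillation at most \<open>N\<close> on
  every ball, where \<open>N\<close> is a multiple of the BMO bound of \<open>f\<close>. On a ball \<open>B\<close> of radius \<open>r\<close> the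
  maximal function is the maximum of two parts. The supremum of the averages over balls of radius greater
  than \<open>r\<close> varies on \<open>B\<close> by at most a multiple of \<open>N\<close>, because two such balls that meet \<open>B\<close> can be
  compared after a slight enlargement. The supremum of the averages over balls of radius at most \<open>r\<close>
  exceeds the mean over \<open>B\<close> by an amount with exponentially decaying distribution function; this is a
  John-Nirenberg inequality for averages (lemmas \<open>measure_exceedance_halves\<close> and
  \<open>small_ball_majorant\<close>), proved by a stopping time argument with a Vitali covering.
  So on \<open>B\<close> the mean distance of the maximal function from a suitable constant \<open>T\<close> is at most a
  multiple of \<open>N\<close> (lemma \<open>maximal_function_near_constant\<close>). This bounds its oscillation, and if the
  radius of \<open>B\<close> is at least critical then all larger concentric balls have bounded mean, so that \<open>T\<close> and
  with it the mean of the maximal function are bounded.\<close>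

section \<open>Means\<close>

lemma mean_nonneg_AE:
  fixes h :: "'a \<Rightarrow> real"
  assumes "AE y in \<mu>. 0 \<le> h y" shows "0 \<le> mean \<mu> B h"
  unfolding mean_def set_lebesgue_integral_def
  by (intro scaleR_nonneg_nonneg integral_nonneg_AE) (use assms in \<open>auto simp: indicator_def\<close>)

lemma mean_nonneg:
  fixes h :: "'a \<Rightarrow> real"
  assumes "\<And>y. 0 \<le> h y" shows "0 \<le> mean \<mu> B h"
  using assms by (intro mean_nonneg_AE) simp

lemma mean_diff:
  fixes f g :: "'a \<Rightarrow> 'b::{banach, second_countable_topology}"
  assumes "set_integrable \<mu> B f" "set_integrable \<mu> B g"
  shows "mean \<mu> B (\<lambda>y. f y - g y) = mean \<mu> B f - mean \<mu> B g"
  by (simp add: mean_def set_integral_diff(2)[OF assms] scaleR_diff_right)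

lemma mean_add:
  fixes f g :: "'a \<Rightarrow> 'b::{banach, second_countable_topology}"
  assumes "set_integrable \<mu> B f" "set_integrable \<mu> B g"
  shows "mean \<mu> B (\<lambda>y. f y + g y) = mean \<mu> B f + mean \<mu> B g"
  by (simp add: mean_def set_integral_add(2)[OF assms] scaleR_add_right)

lemma mean_mono:
  fixes f g :: "'a \<Rightarrow> real"
  assumes "set_integrable \<mu> B f" "set_integrable \<mu> B g" "\<And>y. y \<in> B \<Longrightarrow> f y \<le> g y"
  shows "mean \<mu> B f \<le> mean \<mu> B g"
  unfolding mean_def by (auto intro!: mult_left_mono set_integral_mono assms)

lemma norm_mean_le:
  fixes f :: "'a \<Rightarrow> 'b::{banach, second_countable_topology}"
  shows "norm (mean \<mu> B f) \<le> mean \<mu> B (\<lambda>y. norm (f y))"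
proof -
  have "norm (LINT x:B|\<mu>. f x) \<le> (LINT x:B|\<mu>. norm (f x))"
    unfolding set_lebesgue_integral_def
    by (rule order_trans[OF integral_norm_bound]) simp
  then show ?thesis
    by (simp add: mean_def divide_right_mono mult_left_mono)
qed

text \<open>Jensen's inequality. With \<open>m\<close> the mean of \<open>V\<close>, integrate Young's inequality
  \<open>V m\<^bsup>q - 1\<^esup> \<le> V\<^sup>q / q + m\<^sup>q / q'\<close>, whose two sides agree where \<open>V = m\<close>.\<close>

lemma powr_mean_le_mean_powr:
  fixes \<mu> :: "'a measure" and V :: "'a \<Rightarrow> real"
  assumes q: "1 < q" and B: "0 < measure \<mu> B" "B \<in> sets \<mu>"
    and V: "set_integrable \<mu> B V" "set_integrable \<mu> B (\<lambda>y. V y powr q)"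
    and V0: "AE y in \<mu>. 0 \<le> V y"
  shows "mean \<mu> B V powr q \<le> mean \<mu> B (\<lambda>y. V y powr q)"
proof -
  define m where "m = mean \<mu> B V"
  have fin: "emeasure \<mu> B < \<infinity>"
    using B(1) by (simp add: measure_def) (metis enn2real_top less_irrefl top.not_eq_extremum)
  have m0: "0 \<le> m"
    unfolding m_def by (rule mean_nonneg_AE[OF V0])
  have "0 \<le> mean \<mu> B (\<lambda>y. V y powr q)"
    by (rule mean_nonneg) simp
  show ?thesis
  proof (cases "m = 0")
    case True
    then show ?thesis using \<open>0 \<le> mean _ _ _\<close> by (simp add: m_def)
  next
    case False
    then have m: "0 < m" using m0 by simp
    define q' where "q' = q / (q - 1)"
    have q': "1 < q'" "1 / q + 1 / q' = 1" "(q - 1) * q' = q"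
      using q by (auto simp: q'_def field_simps)
    have const: "set_integrable \<mu> B (\<lambda>_. m powr q / q')"
      unfolding set_integrable_def using fin B(2) by (intro integrable_scaleR_left) auto
    have young: "v * m powr (q - 1) \<le> v powr q / q + m powr q / q'" if "0 \<le> v" for v
      using Youngs_inequality[OF q q'(1,2) that, of "m powr (q - 1)"] by (simp add: powr_powr q'(3))
    have "(LINT y:B|\<mu>. V y * m powr (q - 1)) \<le> (LINT y:B|\<mu>. V y powr q / q + m powr q / q')"
      by (rule set_integral_mono_AE)
        (use V const V0 young in \<open>auto elim!: eventually_mono\<close>)
    also have "\<dots> = (LINT y:B|\<mu>. V y powr q) / q + measure \<mu> B * (m powr q / q')"
      using V const fin B(2) by (subst set_integral_add) (auto simp: set_lebesgue_integral_def)
    finally have "(LINT y:B|\<mu>. V y) * m powr (q - 1)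
        \<le> (LINT y:B|\<mu>. V y powr q) / q + measure \<mu> B * (m powr q / q')" by simp
    then have "((LINT y:B|\<mu>. V y) * m powr (q - 1)) / measure \<mu> B
        \<le> ((LINT y:B|\<mu>. V y powr q) / q + measure \<mu> B * (m powr q / q')) / measure \<mu> B"
      using B(1) by (intro divide_right_mono) auto
    then have "m * m powr (q - 1) \<le> mean \<mu> B (\<lambda>y. V y powr q) / q + m powr q / q'"
      using B(1) by (simp add: mean_def m_def add_divide_distrib field_simps)
    moreover have "m * m powr (q - 1) = m powr q"
      using m by (simp add: powr_diff)
    moreover have "m powr q = m powr q / q + m powr q / q'"
      using q'(2) by (metis distrib_left mult.right_neutral times_divide_eq_right)
    ultimately have "m powr q / q \<le> mean \<mu> B (\<lambda>y. V y powr q) / q" by linarith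
    then show ?thesis using q by (simp add: divide_le_cancel m_def)
  qed
qed

section \<open>Doubling measures\<close>

locale doubling_measure =
  fixes \<mu> :: "'a::euclidean_space measure" and D :: real
  assumes borel_sets: "sets borel \<subseteq> sets \<mu>"
    and space_eq_UNIV: "space \<mu> = UNIV"
    and emeasure_ball_finite: "emeasure \<mu> (ball c r) < \<infinity>"
    and measure_ball_pos: "0 < r \<Longrightarrow> 0 < measure \<mu> (ball c r)"
    and doubling: "0 < r \<Longrightarrow> measure \<mu> (ball c (2 * r)) \<le> D * measure \<mu> (ball c r)"
begin

lemma open_sets: "open S \<Longrightarrow> S \<in> sets \<mu>"
  using borel_sets borel_open by blast

lemma ball_sets [simp, measurable]: "ball c r \<in> sets \<mu>"
  by (rule open_sets) simp

lemma emeasure_ball_eq: "emeasure \<mu> (ball c r) = ennreal (measure \<mu> (ball c r))"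
  by (rule emeasure_eq_ennreal_measure) (use emeasure_ball_finite[of c r] in simp)

lemma fmeasurable_ball: "ball c r \<in> fmeasurable \<mu>"
  using emeasure_ball_finite by (auto simp: fmeasurable_def)

lemma one_le_doubling_constant: "1 \<le> D"
proof -
  have "measure \<mu> (ball 0 1) \<le> measure \<mu> (ball (0::'a) (2 * 1))"
    by (rule measure_mono_fmeasurable[OF _ _ fmeasurable_ball]) auto
  also have "\<dots> \<le> D * measure \<mu> (ball 0 1)"
    by (rule doubling) simp
  finally show ?thesis
    using measure_ball_pos[of 1 0] by simp
qed

lemma doubling_power:
  assumes "0 < r" shows "measure \<mu> (ball c (2 ^ m * r)) \<le> D ^ m * measure \<mu> (ball c r)"
proof (induction m)
  case (Suc m)
  have "measure \<mu> (ball c (2 ^ Suc m * r)) = measure \<mu> (ball c (2 * (2 ^ m * r)))"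
    by (simp add: mult.assoc)
  also have "\<dots> \<le> D * measure \<mu> (ball c (2 ^ m * r))"
    by (rule doubling) (use assms in simp)
  also have "\<dots> \<le> D * (D ^ m * measure \<mu> (ball c r))"
    by (rule mult_left_mono[OF Suc.IH]) (use one_le_doubling_constant in simp)
  finally show ?case by (simp add: mult.assoc)
qed simp

lemma measure_ball_le:
  assumes "0 < r" "dist c c' + r' \<le> 2 ^ m * r"
  shows "measure \<mu> (ball c' r') \<le> D ^ m * measure \<mu> (ball c r)"
proof -
  have "ball c' r' \<subseteq> ball c (2 ^ m * r)"
    using assms(2) by (simp add: ball_subset_ball_iff dist_commute)
  then have "measure \<mu> (ball c' r') \<le> measure \<mu> (ball c (2 ^ m * r))"
    by (rule measure_mono_fmeasurable[OF _ _ fmeasurable_ball]) auto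
  with doubling_power[OF assms(1), of c m] show ?thesis by simp
qed

lemma set_integrable_ball:
  fixes f :: "'a \<Rightarrow> 'b::{banach, second_countable_topology}"
  assumes "locally_integrable \<mu> f" shows "set_integrable \<mu> (ball c r) f"
proof -
  have "set_integrable \<mu> (cball c r) f"
    using assms by (simp add: locally_integrable_def)
  then show ?thesis
    by (rule set_integrable_subset) auto
qed

lemma set_integrable_const: "set_integrable \<mu> (ball c r) (\<lambda>_. a::'b::{banach, second_countable_topology})"
  unfolding set_integrable_def
  by (rule integrable_scaleR_left)
    (use emeasure_ball_finite in \<open>auto\<close>)

lemma set_integral_const: "(LINT x:ball c r|\<mu>. a) = measure \<mu> (ball c r) *\<^sub>R (a::'b::{banach, second_countable_topology})"
  using emeasure_ball_finite[of c r]
  by (simp add: set_lebesgue_integral_def space_eq_UNIV)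

lemma mean_const:
  "0 < r \<Longrightarrow> mean \<mu> (ball c r) (\<lambda>_. a) = (a::'b::{banach, second_countable_topology})"
  using measure_ball_pos[of r c] by (simp add: mean_def set_integral_const)

lemma norm_mean_diff_le:
  fixes f :: "'a \<Rightarrow> 'b::{banach, second_countable_topology}"
  assumes f: "locally_integrable \<mu> f" and "0 < r"
  shows "norm (mean \<mu> (ball c r) f - a) \<le> mean \<mu> (ball c r) (\<lambda>y. norm (f y - a))"
proof -
  have "mean \<mu> (ball c r) f - a = mean \<mu> (ball c r) (\<lambda>y. f y - a)"
    using mean_diff[OF set_integrable_ball[OF f] set_integrable_const, of c r a]
      mean_const[OF \<open>0 < r\<close>, of c a] by simp
  then show ?thesis
    using norm_mean_le by simp
qed

lemma locally_integrable_norm_diff: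
  fixes f :: "'a \<Rightarrow> 'b::{banach, second_countable_topology}"
  assumes "locally_integrable \<mu> f" shows "locally_integrable \<mu> (\<lambda>y. norm (f y - a))"
  unfolding locally_integrable_def
proof (intro allI impI)
  fix K :: "'a set" assume "compact K"
  then obtain r where K: "K \<subseteq> ball 0 r"
    using bounded_subset_ballD compact_imp_bounded by blast
  have "set_integrable \<mu> (ball 0 r) (\<lambda>y. f y - a)"
    by (intro set_integral_diff set_integrable_ball assms set_integrable_const)
  then have "set_integrable \<mu> (ball 0 r) (\<lambda>y. norm (f y - a))"
    unfolding set_integrable_def by (drule_tac integrable_norm) simp
  moreover have "K \<in> sets \<mu>"
    using borel_sets \<open>compact K\<close> by (auto dest: compact_imp_closed borel_closed)
  ultimately show "set_integrable \<mu> K (\<lambda>y. norm (f y - a))"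
    using K by (rule set_integrable_subset)
qed

lemma locally_integrable_norm:
  fixes f :: "'a \<Rightarrow> 'b::{banach, second_countable_topology}"
  assumes "locally_integrable \<mu> f" shows "locally_integrable \<mu> (\<lambda>y. norm (f y))"
  using locally_integrable_norm_diff[OF assms, of 0] by simp

lemma set_integral_eq_mean:
  "0 < r \<Longrightarrow> (LINT x:ball c r|\<mu>. h x) = measure \<mu> (ball c r) * mean \<mu> (ball c r) (h :: 'a \<Rightarrow> real)"
  using measure_ball_pos[of r c] by (simp add: mean_def)

text \<open>The two distance conditions express that \<open>ball c r\<close> lies in \<open>ball c' r'\<close> and that the larger ball
  is covered after \<open>m\<close> doublings of the smaller one. All comparisons of means below reduce to
  counting such doublings.\<close>

lemma mean_le_mean_superset:
  fixes h :: "'a \<Rightarrow> real"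
  assumes h: "locally_integrable \<mu> h" "\<And>y. 0 \<le> h y"
    and r: "0 < r" and sub: "dist c c' + r \<le> r'" and sup: "dist c c' + r' \<le> 2 ^ m * r"
  shows "mean \<mu> (ball c r) h \<le> D ^ m * mean \<mu> (ball c' r') h"
proof -
  have r': "0 < r'" using r sub zero_le_dist[of c c'] by linarith
  have "ball c r \<subseteq> ball c' r'"
    using sub by (simp add: ball_subset_ball_iff)
  then have "(LINT x:ball c r|\<mu>. h x) \<le> (LINT x:ball c' r'|\<mu>. h x)"
    unfolding set_lebesgue_integral_def
    using set_integrable_ball[OF h(1)] h(2)
    by (intro integral_mono) (auto simp: set_integrable_def indicator_def)
  also have "\<dots> = measure \<mu> (ball c' r') * mean \<mu> (ball c' r') h"
    by (rule set_integral_eq_mean[OF r'])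
  also have "\<dots> \<le> (D ^ m * measure \<mu> (ball c r)) * mean \<mu> (ball c' r') h"
    by (rule mult_right_mono[OF measure_ball_le[OF r sup] mean_nonneg[OF h(2)]])
  finally show ?thesis
    unfolding set_integral_eq_mean[OF r] using measure_ball_pos[OF r, of c]
    by (simp add: mult.assoc mult.left_commute)
qed

text \<open>The mean is, up to the factor \<open>2\<close>, the best approximation by a constant. Hence oscillations can be
  bounded by producing any convenient constant.\<close>

lemma mean_oscillation_le:
  fixes f :: "'a \<Rightarrow> 'b::{banach, second_countable_topology}"
  assumes f: "locally_integrable \<mu> f" and r: "0 < r"
  shows "mean \<mu> (ball c r) (\<lambda>y. norm (f y - mean \<mu> (ball c r) f))
    \<le> 2 * mean \<mu> (ball c r) (\<lambda>y. norm (f y - a))"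
proof -
  let ?B = "ball c r" let ?m = "mean \<mu> ?B f"
  note int = set_integrable_ball[OF locally_integrable_norm_diff[OF f]] set_integrable_const
  have "mean \<mu> ?B (\<lambda>y. norm (f y - ?m)) \<le> mean \<mu> ?B (\<lambda>y. norm (f y - a) + norm (?m - a))"
    by (intro mean_mono int set_integral_add)
      (use norm_triangle_ineq4[of "f _ - a" "?m - a"] in simp)
  also have "\<dots> = mean \<mu> ?B (\<lambda>y. norm (f y - a)) + norm (?m - a)"
    by (simp add: mean_add int mean_const[OF r])
  also have "\<dots> \<le> 2 * mean \<mu> ?B (\<lambda>y. norm (f y - a))"
    using norm_mean_diff_le[OF f r] by simp
  finally show ?thesis .
qed

lemma mean_diff_nested_le:
  fixes g :: "'a \<Rightarrow> real"
  assumes g: "locally_integrable \<mu> g"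
    and osc: "\<And>c r. 0 < r \<Longrightarrow> mean \<mu> (ball c r) (\<lambda>y. \<bar>g y - mean \<mu> (ball c r) g\<bar>) \<le> N"
    and r: "0 < r" and sub: "dist c c' + r \<le> r'" and sup: "dist c c' + r' \<le> 2 ^ m * r"
  shows "\<bar>mean \<mu> (ball c r) g - mean \<mu> (ball c' r') g\<bar> \<le> D ^ m * N"
proof -
  let ?a = "mean \<mu> (ball c' r') g"
  have r': "0 < r'" using r sub zero_le_dist[of c c'] by linarith
  have "\<bar>mean \<mu> (ball c r) g - ?a\<bar> \<le> mean \<mu> (ball c r) (\<lambda>y. \<bar>g y - ?a\<bar>)"
    using norm_mean_diff_le[OF g r] by simp
  also have "\<dots> \<le> D ^ m * mean \<mu> (ball c' r') (\<lambda>y. \<bar>g y - ?a\<bar>)"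
    by (rule mean_le_mean_superset[OF _ _ r sub sup])
      (use locally_integrable_norm_diff[OF g] in auto)
  also have "\<dots> \<le> D ^ m * N"
    using osc[OF r'] one_le_doubling_constant by (simp add: mult_left_mono)
  finally show ?thesis .
qed

lemma mean_deviation_dilated_le:
  fixes g :: "'a \<Rightarrow> real"
  assumes g: "locally_integrable \<mu> g"
    and osc: "\<And>c r. 0 < r \<Longrightarrow> mean \<mu> (ball c r) (\<lambda>y. \<bar>g y - mean \<mu> (ball c r) g\<bar>) \<le> N"
    and r: "0 < r"
  shows "mean \<mu> (ball c (2 ^ m * r)) (\<lambda>y. \<bar>g y - mean \<mu> (ball c r) g\<bar>) \<le> 2 * D ^ m * N"
proof -
  let ?B = "ball c (2 ^ m * r)"
  let ?a = "mean \<mu> (ball c r) g" and ?b = "mean \<mu> ?B g"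
  have r': "0 < 2 ^ m * r" using r by simp
  have N: "0 \<le> N"
    by (rule order_trans[OF mean_nonneg osc[OF r]]) simp
  have *: "r \<le> 2 ^ m * r" using r by simp
  have "mean \<mu> ?B (\<lambda>y. \<bar>g y - ?a\<bar>) \<le> mean \<mu> ?B (\<lambda>y. \<bar>g y - ?b\<bar> + \<bar>?a - ?b\<bar>)"
    using set_integrable_ball[OF locally_integrable_norm_diff[OF g]]
    by (intro mean_mono set_integral_add set_integrable_const) auto
  also have "\<dots> = mean \<mu> ?B (\<lambda>y. \<bar>g y - ?b\<bar>) + \<bar>?a - ?b\<bar>"
    using set_integrable_ball[OF locally_integrable_norm_diff[OF g]]
    by (simp add: mean_add set_integrable_const mean_const[OF r'])
  also have "\<dots> \<le> N + D ^ m * N"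
    using osc[OF r'] mean_diff_nested_le[OF g osc r, of c c _ m] * by (intro add_mono) auto
  also have "\<dots> \<le> D ^ m * N + D ^ m * N"
    using mult_right_mono[OF one_le_power[OF one_le_doubling_constant, of m] N] by (simp add: mult.commute)
  finally show ?thesis by (simp add: mult_ac)
qed

section \<open>Exponential decay of maximal averages over small balls\<close>

text \<open>The part of a ball on which the maximal averages over balls of no larger radius exceed the mean of
  the whole ball by more than \<open>t\<close>. Working with averages instead of the values of \<open>g\<close> makes the
  set open.\<close>

definition exceedance :: "('a \<Rightarrow> real) \<Rightarrow> 'a \<Rightarrow> real \<Rightarrow> real \<Rightarrow> 'a set" where
  "exceedance g c r t = {y \<in> ball c r. \<exists>z s. 0 < s \<and> s \<le> r \<and> y \<in> ball z s \<and>
     mean \<mu> (ball c r) g + t < mean \<mu> (ball z s) g}"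

lemma open_exceedance: "open (exceedance g c r t)"
proof -
  have *: "exceedance g c r t = ball c r \<inter> (\<Union>(z, s) \<in> {(z, s). 0 < s \<and> s \<le> r \<and>
     mean \<mu> (ball c r) g + t < mean \<mu> (ball z s) g}. ball z s)"
    unfolding exceedance_def by blast
  show ?thesis unfolding * by (rule open_Int) auto
qed

lemma fmeasurable_exceedance: "exceedance g c r t \<in> fmeasurable \<mu>"
  by (rule fmeasurableI2[OF fmeasurable_ball[of c r] _ open_sets[OF open_exceedance]])
    (auto simp: exceedance_def)

text \<open>The stopping time argument of John and Nirenberg, applied to averages. Around a point \<open>y\<close> of the
  exceedance set at level \<open>t + K\<close> some average of \<open>\<bar>g - a\<bar>\<close> is above \<open>l\<close>, where \<open>a\<close> is the mean of
  \<open>g\<close> over the given ball. Choose a radius \<open>\<rho> y\<close> with this property that is maximal up to the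
  factor \<open>2\<close>. On the one hand, the Chebyshev inequality shows that disjoint balls of this kind have small
  total measure. On the other hand, five times such a ball has a mean that differs from \<open>a\<close> by at
  most \<open>K\<close>, since its radius is beyond the supremum or comparable to \<open>r\<close>. A Vitali selection of these balls, dilated by
  the factor \<open>5\<close>, covers the exceedance set; moreover the small ball that witnesses the exceedance
  at \<open>y\<close> is still admissible for the selected dilated ball, with the level reduced from \<open>t + K\<close> to
  \<open>t\<close>. The constant \<open>4 D\<^bsup>11\<^esup>\<close> is what makes the dilated balls fill at most half of
  the given ball.\<close>

lemma measure_exceedance_halves:
  fixes g :: "'a \<Rightarrow> real"
  assumes g: "locally_integrable \<mu> g"
    and osc: "\<And>c r. 0 < r \<Longrightarrow> mean \<mu> (ball c r) (\<lambda>y. \<bar>g y - mean \<mu> (ball c r) g\<bar>) \<le> N"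
    and N: "0 < N" and K: "K = 4 * D ^ 11 * N" and t: "0 \<le> t"
    and IH: "\<And>c r. 0 < r \<Longrightarrow> measure \<mu> (exceedance g c r t) \<le> p * measure \<mu> (ball c r)"
    and r: "0 < r"
  shows "measure \<mu> (exceedance g c r (t + K)) \<le> p / 2 * measure \<mu> (ball c r)"
proof -
  note D = one_le_doubling_constant
  let ?a = "mean \<mu> (ball c r) g"
  let ?h = "\<lambda>y. \<bar>g y - ?a\<bar>"
  let ?E = "exceedance g c r (t + K)"
  have h: "locally_integrable \<mu> ?h"
    using locally_integrable_norm_diff[OF g, of ?a] by simp
  have K0: "0 < K" using K N D by simp
  have p: "0 \<le> p"
    using order_trans[OF measure_nonneg IH[OF r, of c]] measure_ball_pos[OF r, of c]
    by (simp add: zero_le_mult_iff)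
  (* A ball of radius s through y sits in the ball of radius 2 * s around y; recentering costs D^2. *)
  define l where "l = K / D ^ 2"
  have l: "0 < l" "l \<le> K" using K0 D by (auto simp: l_def divide_le_eq)
  define S where "S y = {u. 0 < u \<and> u \<le> 4 * r \<and> l < mean \<mu> (ball y u) ?h}" for y
  have bdd: "bdd_above (S y)" for y
    unfolding S_def by (rule bdd_aboveI[of _ "4 * r"]) auto
  have in_S: "2 * s \<in> S y"
    if "0 < s" "s \<le> r" "y \<in> ball z s" "?a + (t + K) < mean \<mu> (ball z s) g" for y z s
  proof -
    have "K < \<bar>mean \<mu> (ball z s) g - ?a\<bar>" using that t by linarith
    also have "\<dots> \<le> mean \<mu> (ball z s) ?h"
      using norm_mean_diff_le[OF g \<open>0 < s\<close>] by simp
    also have "\<dots> \<le> D ^ 2 * mean \<mu> (ball y (2 * s)) ?h"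
      by (rule mean_le_mean_superset[OF h]) (use that in \<open>auto simp: dist_commute\<close>)
    finally have "l < mean \<mu> (ball y (2 * s)) ?h"
      using D by (simp add: l_def divide_less_eq mult.commute)
    then show ?thesis using that r by (simp add: S_def)
  qed
  have "\<forall>y\<in>?E. \<exists>u\<in>S y. Sup (S y) < 2 * u"
  proof
    fix y assume "y \<in> ?E"
    then obtain z s where zs: "0 < s" "s \<le> r" "y \<in> ball z s" "?a + (t + K) < mean \<mu> (ball z s) g"
      by (auto simp: exceedance_def)
    have "0 < Sup (S y)"
      using cSup_upper[OF in_S[OF zs] bdd] \<open>0 < s\<close> by linarith
    then have "Sup (S y) / 2 < Sup (S y)" by simp
    then obtain u where "u \<in> S y" "Sup (S y) / 2 < u"
      using less_cSupD in_S[OF zs] by blast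
    then show "\<exists>u\<in>S y. Sup (S y) < 2 * u" by force
  qed
  then obtain \<rho> where \<rho>: "\<And>y. y \<in> ?E \<Longrightarrow> \<rho> y \<in> S y" "\<And>y. y \<in> ?E \<Longrightarrow> Sup (S y) < 2 * \<rho> y"
    by metis
  have \<rho>_pos: "0 < \<rho> y" "\<rho> y \<le> 4 * r" if "y \<in> ?E" for y
    using \<rho>(1)[OF that] by (auto simp: S_def)
  have E_ball: "dist c y < r" if "y \<in> ?E" for y
    using that by (simp add: exceedance_def)
  obtain C where C: "countable C" "C \<subseteq> ?E"
     and disj: "pairwise (\<lambda>i j. disjnt (cball i (\<rho> i)) (cball j (\<rho> j))) C"
     and cover: "\<And>i. i \<in> ?E \<Longrightarrow> \<exists>j. j \<in> C \<and> \<not> disjnt (cball i (\<rho> i)) (cball j (\<rho> j)) \<and>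
        cball i (\<rho> i) \<subseteq> ball j (5 * \<rho> j)"
    using Vitali_covering_lemma_cballs_balls[of ?E \<rho> "4 * r" "\<lambda>x. x"] \<rho>_pos by auto
  (* Either 5 * \<rho> i is an admissible radius beyond the supremum, so that the mean is at most l, or the
     ball is comparable to the given one and the mean is controlled by the oscillation of g. *)
  have deviation: "\<bar>mean \<mu> (ball i (5 * \<rho> i)) g - ?a\<bar> \<le> K" if "i \<in> ?E" for i
  proof -
    have pos: "0 < 5 * \<rho> i" using \<rho>_pos[OF that] by simp
    have "5 * \<rho> i \<notin> S i"
      using cSup_upper[OF _ bdd[of i], of "5 * \<rho> i"] \<rho>(2)[OF that] \<rho>_pos[OF that] by linarith
    then consider "4 * r < 5 * \<rho> i" | "mean \<mu> (ball i (5 * \<rho> i)) ?h \<le> l"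
      using pos by (force simp: S_def)
    then have "mean \<mu> (ball i (5 * \<rho> i)) ?h \<le> K"
    proof cases
      case 1
      have "mean \<mu> (ball i (5 * \<rho> i)) ?h \<le> D ^ 4 * mean \<mu> (ball c (2 ^ 5 * r)) ?h"
        by (rule mean_le_mean_superset[OF h _ pos])
          (use E_ball[OF that] \<rho>_pos[OF that] 1 in \<open>auto simp: dist_commute\<close>)
      also have "\<dots> \<le> D ^ 4 * (2 * D ^ 5 * N)"
        by (rule mult_left_mono[OF mean_deviation_dilated_le[OF g osc r]]) (use D in auto)
      also have "\<dots> = 2 * D ^ 9 * N" by (simp add: power_add[symmetric])
      also have "\<dots> \<le> 4 * D ^ 11 * N"
        by (rule mult_right_mono[OF mult_mono]) (use D N in \<open>auto intro: power_increasing\<close>)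
      finally show ?thesis by (simp add: K)
    next
      case 2
      then show ?thesis using l by simp
    qed
    then show ?thesis
      using norm_mean_diff_le[OF g pos, of i ?a] by simp
  qed
  have sub: "?E \<subseteq> (\<Union>i\<in>C. exceedance g i (5 * \<rho> i) t)"
  proof
    fix y assume y: "y \<in> ?E"
    then obtain z s where zs: "0 < s" "s \<le> r" "y \<in> ball z s" "?a + (t + K) < mean \<mu> (ball z s) g"
      by (auto simp: exceedance_def)
    obtain j where j: "j \<in> C" "cball y (\<rho> y) \<subseteq> ball j (5 * \<rho> j)"
      using cover[OF y] by blast
    have "2 * s < 2 * \<rho> y"
      using cSup_upper[OF in_S[OF zs] bdd] \<rho>(2)[OF y] by linarith
    moreover have le: "dist y j + \<rho> y < 5 * \<rho> j"
      using j(2) \<rho>_pos[OF y] by (simp add: cball_subset_ball_iff)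
    ultimately have "s \<le> 5 * \<rho> j" using zero_le_dist[of y j] by linarith
    moreover have "mean \<mu> (ball j (5 * \<rho> j)) g + t < mean \<mu> (ball z s) g"
      using deviation[of j] j(1) C(2) zs(4) by force
    moreover have "y \<in> ball j (5 * \<rho> j)"
      using le \<rho>_pos[OF y] by (simp add: dist_commute)
    ultimately have "y \<in> exceedance g j (5 * \<rho> j) t"
      using zs unfolding exceedance_def by blast
    then show "y \<in> (\<Union>i\<in>C. exceedance g i (5 * \<rho> i) t)" using j(1) by blast
  qed
  have bound: "measure \<mu> (\<Union>i\<in>I. exceedance g i (5 * \<rho> i) t) \<le> p / 2 * measure \<mu> (ball c r)"
    if I: "I \<subseteq> C" "finite I" for I
  proof -
    have IE: "i \<in> ?E" if "i \<in> I" for i using that I C(2) by blast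
    have dis: "disjoint_family_on (\<lambda>i. ball i (\<rho> i)) I"
      unfolding disjoint_family_on_def
    proof (intro ballI impI)
      fix i j assume ij: "i \<in> I" "j \<in> I" "i \<noteq> j"
      then have "disjnt (cball i (\<rho> i)) (cball j (\<rho> j))"
        using disj I(1) by (auto simp: pairwise_def)
      then show "ball i (\<rho> i) \<inter> ball j (\<rho> j) = {}"
        unfolding disjnt_def using ball_subset_cball by blast
    qed
    have intble: "set_integrable \<mu> (ball x s) ?h" for x s
      by (rule set_integrable_ball[OF h])
    have inball: "ball i (\<rho> i) \<subseteq> ball c (2 ^ 3 * r)" if "i \<in> I" for i
      using E_ball[OF IE[OF that]] \<rho>_pos[OF IE[OF that]] by (simp add: ball_subset_ball_iff dist_commute)
    have "l * (\<Sum>i\<in>I. measure \<mu> (ball i (\<rho> i))) = (\<Sum>i\<in>I. measure \<mu> (ball i (\<rho> i)) * l)"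
      by (simp add: sum_distrib_left mult.commute)
    also have "\<dots> \<le> (\<Sum>i\<in>I. LINT x:ball i (\<rho> i)|\<mu>. ?h x)"
    proof (rule sum_mono)
      fix i assume "i \<in> I"
      then have "0 < \<rho> i" "l < mean \<mu> (ball i (\<rho> i)) ?h"
        using \<rho>(1)[OF IE] by (auto simp: S_def)
      then show "measure \<mu> (ball i (\<rho> i)) * l \<le> (LINT x:ball i (\<rho> i)|\<mu>. ?h x)"
        by (simp add: set_integral_eq_mean mult_left_mono)
    qed
    also have "\<dots> = (LINT x:(\<Union>i\<in>I. ball i (\<rho> i))|\<mu>. ?h x)"
      by (rule set_integral_finite_Union[symmetric]) (use I dis intble in auto)
    also have "\<dots> \<le> (LINT x:ball c (2 ^ 3 * r)|\<mu>. ?h x)"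
    proof -
      have "(\<Union>i\<in>I. ball i (\<rho> i)) \<subseteq> ball c (2 ^ 3 * r)" using inball by blast
      moreover have "set_integrable \<mu> (\<Union>i\<in>I. ball i (\<rho> i)) ?h"
        by (rule set_integrable_subset[OF intble _ calculation]) (use I in auto)
      ultimately show ?thesis
        using intble unfolding set_lebesgue_integral_def set_integrable_def
        by (intro integral_mono) (use inball in \<open>auto simp: indicator_def subset_iff\<close>)
    qed
    also have "\<dots> = measure \<mu> (ball c (2 ^ 3 * r)) * mean \<mu> (ball c (2 ^ 3 * r)) ?h"
      by (rule set_integral_eq_mean) (use r in simp)
    also have "\<dots> \<le> (D ^ 3 * measure \<mu> (ball c r)) * (2 * D ^ 3 * N)"
      by (intro mult_mono doubling_power mean_deviation_dilated_le g osc r mean_nonneg) (use D in auto)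
    finally have small: "l * (\<Sum>i\<in>I. measure \<mu> (ball i (\<rho> i))) \<le> 2 * D ^ 6 * N * measure \<mu> (ball c r)"
      by (simp add: power_add[symmetric] mult_ac)
    (* D^3 for the dilation, 2 * D^6 * N from the previous estimate and D^2 / K from 1 / l make 1/2. *)
    have "(\<Sum>i\<in>I. measure \<mu> (ball i (5 * \<rho> i))) \<le> (\<Sum>i\<in>I. D ^ 3 * measure \<mu> (ball i (\<rho> i)))"
      using \<rho>_pos[OF IE] by (intro sum_mono measure_ball_le) auto
    also have "\<dots> = D ^ 3 * (\<Sum>i\<in>I. measure \<mu> (ball i (\<rho> i)))"
      by (simp add: sum_distrib_left)
    also have "\<dots> \<le> D ^ 3 * (2 * D ^ 6 * N * measure \<mu> (ball c r) / l)"
      using small l(1) D by (intro mult_left_mono) (auto simp: pos_le_divide_eq mult.commute)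
    also have "\<dots> = measure \<mu> (ball c r) / 2"
      using D N by (simp add: l_def K field_simps power_add[symmetric])
    finally have total: "(\<Sum>i\<in>I. measure \<mu> (ball i (5 * \<rho> i))) \<le> measure \<mu> (ball c r) / 2" .
    have "measure \<mu> (\<Union>i\<in>I. exceedance g i (5 * \<rho> i) t)
        \<le> (\<Sum>i\<in>I. measure \<mu> (exceedance g i (5 * \<rho> i) t))"
      by (rule measure_UNION_le[OF I(2)]) (rule open_sets[OF open_exceedance])
    also have "\<dots> \<le> (\<Sum>i\<in>I. p * measure \<mu> (ball i (5 * \<rho> i)))"
      using \<rho>_pos[OF IE] by (intro sum_mono IH) auto
    also have "\<dots> = p * (\<Sum>i\<in>I. measure \<mu> (ball i (5 * \<rho> i)))"
      by (simp add: sum_distrib_left)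
    also have "\<dots> \<le> p * (measure \<mu> (ball c r) / 2)"
      by (rule mult_left_mono[OF total p])
    finally show ?thesis by simp
  qed
  have "measure \<mu> ?E \<le> measure \<mu> (\<Union>i\<in>C. exceedance g i (5 * \<rho> i) t)"
    by (rule measure_mono_fmeasurable[OF sub fmeasurableD[OF fmeasurable_exceedance]
          fmeasurable_UN_bound[OF C(1) fmeasurable_exceedance bound]]) 
  also have "\<dots> \<le> p / 2 * measure \<mu> (ball c r)"
    by (rule measure_UN_bound[OF C(1) fmeasurable_exceedance bound])
  finally show ?thesis .
qed

text \<open>The induction runs over all balls simultaneously, because each step passes to the selected balls.\<close>

lemma measure_exceedance_decay:
  fixes g :: "'a \<Rightarrow> real"
  assumes g: "locally_integrable \<mu> g"
    and osc: "\<And>c r. 0 < r \<Longrightarrow> mean \<mu> (ball c r) (\<lambda>y. \<bar>g y - mean \<mu> (ball c r) g\<bar>) \<le> N"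
    and N: "0 < N" and K: "K = 4 * D ^ 11 * N" and r: "0 < r"
  shows "measure \<mu> (exceedance g c r (real j * K)) \<le> (1/2) ^ j * measure \<mu> (ball c r)"
  using r
proof (induction j arbitrary: c r)
  case 0
  show ?case
    by (simp, rule measure_mono_fmeasurable[OF _ fmeasurableD[OF fmeasurable_exceedance] fmeasurable_ball])
      (auto simp: exceedance_def)
next
  case (Suc j)
  have "0 \<le> real j * K"
    using K N one_le_doubling_constant by simp
  from measure_exceedance_halves[OF g osc N K this Suc.IH Suc.prems]
  show ?case by (simp add: algebra_simps)
qed

text \<open>The layer cake form of the decay estimate: the sum of \<open>K\<close> times the indicators of the exceedance
  sets at the levels \<open>j K\<close> dominates the excess of every small average, and its integral is a
  geometric series.\<close>

lemma small_ball_majorant: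
  fixes g :: "'a \<Rightarrow> real"
  assumes g: "locally_integrable \<mu> g" and g0: "\<And>y. 0 \<le> g y"
    and osc: "\<And>c r. 0 < r \<Longrightarrow> mean \<mu> (ball c r) (\<lambda>y. \<bar>g y - mean \<mu> (ball c r) g\<bar>) \<le> N"
    and N: "0 < N" and K: "K = 4 * D ^ 11 * N" and r: "0 < r"
  obtains \<phi> :: "'a \<Rightarrow> ennreal" where
    "\<phi> \<in> borel_measurable \<mu>"
    "(\<integral>\<^sup>+y. \<phi> y \<partial>\<mu>) \<le> ennreal (2 * K * measure \<mu> (ball c r))"
    "\<And>y z s. y \<in> ball c r \<Longrightarrow> 0 < s \<Longrightarrow> s \<le> r \<Longrightarrow> y \<in> ball z s \<Longrightarrow>
       ennreal (mean \<mu> (ball z s) g) \<le> ennreal (mean \<mu> (ball c r) g) + \<phi> y"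
proof
  let ?E = "\<lambda>j. exceedance g c r (real j * K)"
  let ?\<phi> = "\<lambda>y. \<Sum>j. ennreal K * indicator (?E j) y"
  have K0: "0 < K" using K N one_le_doubling_constant by simp
  have [measurable]: "?E j \<in> sets \<mu>" for j
    by (rule open_sets[OF open_exceedance])
  show "?\<phi> \<in> borel_measurable \<mu>" by measurable
  have "(\<integral>\<^sup>+y. ?\<phi> y \<partial>\<mu>) = (\<Sum>j. ennreal K * emeasure \<mu> (?E j))"
    by (subst nn_integral_suminf) (auto simp: nn_integral_cmult_indicator)
  also have "\<dots> \<le> (\<Sum>j. ennreal ((1/2) ^ j * (K * measure \<mu> (ball c r))))"
  proof (intro suminf_le)
    fix j
    have "ennreal K * emeasure \<mu> (?E j) = ennreal (K * measure \<mu> (?E j))"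
      using fmeasurable_exceedance[of g c r "real j * K"] K0
      by (simp add: emeasure_eq_measure2 ennreal_mult)
    also have "\<dots> \<le> ennreal (K * ((1/2) ^ j * measure \<mu> (ball c r)))"
      using measure_exceedance_decay[OF g osc N K r] K0
      by (intro ennreal_leI mult_left_mono) auto
    finally show "ennreal K * emeasure \<mu> (?E j) \<le> ennreal ((1/2) ^ j * (K * measure \<mu> (ball c r)))"
      by (simp add: mult_ac)
  qed auto
  also have "\<dots> = ennreal (2 * (K * measure \<mu> (ball c r)))"
    using K0 geometric_sums[of "1/2::real"]
    by (intro suminf_ennreal_eq sums_mult2) auto
  finally show "(\<integral>\<^sup>+y. ?\<phi> y \<partial>\<mu>) \<le> ennreal (2 * K * measure \<mu> (ball c r))"
    by (simp add: mult.assoc)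
  fix y z s assume ys: "y \<in> ball c r" "0 < s" "s \<le> r" "y \<in> ball z s"
  define v where "v = mean \<mu> (ball z s) g - mean \<mu> (ball c r) g"
  (* y lies in the exceedance sets of the levels 0, K, ..., (n - 1) * K, and n * K is at least v. *)
  define n where "n = nat \<lceil>v / K\<rceil>"
  have in_E: "y \<in> ?E j" if "j < n" for j
  proof -
    have "real j < v / K" using that unfolding n_def by linarith
    then have "real j * K < v" using K0 by (simp add: pos_less_divide_eq)
    then show ?thesis using ys unfolding exceedance_def v_def by force
  qed
  have "v / K \<le> real n" unfolding n_def by linarith
  then have "v \<le> real n * K" using K0 by (simp add: pos_divide_le_eq)
  then have "ennreal v \<le> ennreal (real n * K)" by (rule ennreal_leI)
  also have "\<dots> = (\<Sum>j<n. ennreal K * indicator (?E j) y)"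
    using in_E K0 by (simp add: ennreal_mult ennreal_of_nat_eq_real_of_nat)
  also have "\<dots> \<le> ?\<phi> y" by (rule sum_le_suminf) auto
  finally have "ennreal v \<le> ?\<phi> y" .
  then have "ennreal (mean \<mu> (ball c r) g) + ennreal v \<le> ennreal (mean \<mu> (ball c r) g) + ?\<phi> y"
    by (rule add_left_mono)
  moreover have "ennreal (mean \<mu> (ball z s) g) \<le> ennreal (mean \<mu> (ball c r) g) + ennreal v"
    using mean_nonneg[of g] g0
    by (cases "0 \<le> v") (auto simp: v_def ennreal_plus[symmetric] ennreal_leI add_increasing2 simp del: ennreal_plus)
  ultimately show "ennreal (mean \<mu> (ball z s) g) \<le> ennreal (mean \<mu> (ball c r) g) + ?\<phi> y"
    by (rule order_trans[rotated])
qed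

section \<open>The maximal function on a ball\<close>

lemma mean_le_maximal_function:
  fixes g :: "'a \<Rightarrow> real"
  assumes "\<And>y. 0 \<le> g y" "0 < s" "y \<in> ball z s"
  shows "ennreal (mean \<mu> (ball z s) g) \<le> maximal_function \<mu> g y"
proof -
  have "(\<lambda>y. norm (g y)) = g" using assms(1) by auto
  then show ?thesis
    unfolding maximal_function_def using assms(2,3) by (intro SUP_upper2[of "(z, s)"]) auto
qed

lemma maximal_function_leI:
  fixes g :: "'a \<Rightarrow> real"
  assumes "\<And>y. 0 \<le> g y"
    and "\<And>z s. 0 < s \<Longrightarrow> y \<in> ball z s \<Longrightarrow> ennreal (mean \<mu> (ball z s) g) \<le> a"
  shows "maximal_function \<mu> g y \<le> a"
proof -
  have "(\<lambda>y. norm (g y)) = g" using assms(1) by auto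
  then show ?thesis
    unfolding maximal_function_def using assms(2) by (intro SUP_least) auto
qed

text \<open>The superlevel sets are unions of open balls, since the maximal function is uncentered.\<close>

lemma borel_measurable_maximal_function: "maximal_function \<mu> f \<in> borel_measurable \<mu>"
proof (rule borel_measurableI_greater)
  fix a
  let ?m = "\<lambda>z s. ennreal (mean \<mu> (ball z s) (\<lambda>y. norm (f y)))"
  have "{y \<in> space \<mu>. a < maximal_function \<mu> f y}
      = (\<Union>(z, s) \<in> {(z, s). 0 < s \<and> a < ?m z s}. ball z s)"
    by (auto simp: maximal_function_def less_SUP_iff space_eq_UNIV) blast
  also have "\<dots> \<in> sets \<mu>" by (rule open_sets) auto
  finally show "{y \<in> space \<mu>. a < maximal_function \<mu> f y} \<in> sets \<mu>" .
qed

text \<open>Split the balls through a point \<open>y\<close> of \<open>ball x r\<close> by their radius. Averages over radii greater than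
  \<open>r\<close> hardly depend on \<open>y\<close>: enlarging such a ball by \<open>2 r\<close> makes it contain all of \<open>ball x r\<close> and
  changes its mean by at most \<open>D\<^sup>2 N\<close>. So their supremum \<open>T\<close>, taken over all large balls that meet
  \<open>ball x r\<close>, is almost a lower bound for the maximal function. Averages over radii up to \<open>r\<close>
  exceed the mean over \<open>ball x r\<close>, and therefore \<open>T\<close>, by a function with small integral.
  The bound \<open>W\<close> serves to make \<open>T\<close> finite, and to control it on large balls.\<close>

lemma maximal_function_near_constant:
  fixes g :: "'a \<Rightarrow> real"
  assumes g: "locally_integrable \<mu> g" and g0: "\<And>y. 0 \<le> g y"
    and osc: "\<And>c r. 0 < r \<Longrightarrow> mean \<mu> (ball c r) (\<lambda>y. \<bar>g y - mean \<mu> (ball c r) g\<bar>) \<le> N"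
    and N: "0 < N" and K: "K = 4 * D ^ 11 * N" and r: "0 < r"
    and W: "\<And>s. r \<le> s \<Longrightarrow> mean \<mu> (ball x s) g \<le> W"
  obtains T \<phi> where "0 \<le> T" "T \<le> D ^ 3 * W"
    "\<phi> \<in> borel_measurable \<mu>" "(\<integral>\<^sup>+y. \<phi> y \<partial>\<mu>) \<le> ennreal (2 * K * measure \<mu> (ball x r))"
    "\<And>y. y \<in> ball x r \<Longrightarrow> maximal_function \<mu> g y \<le> ennreal (T + D ^ 2 * N) + \<phi> y"
    "\<And>y. y \<in> ball x r \<Longrightarrow> ennreal T \<le> maximal_function \<mu> g y + ennreal (D ^ 2 * N)"
proof -
  note D = one_le_doubling_constant
  let ?M = "maximal_function \<mu> g"
  obtain \<phi> :: "'a \<Rightarrow> ennreal" where \<phi>: "\<phi> \<in> borel_measurable \<mu>"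
    "(\<integral>\<^sup>+y. \<phi> y \<partial>\<mu>) \<le> ennreal (2 * K * measure \<mu> (ball x r))"
    "\<And>y z s. y \<in> ball x r \<Longrightarrow> 0 < s \<Longrightarrow> s \<le> r \<Longrightarrow> y \<in> ball z s \<Longrightarrow>
       ennreal (mean \<mu> (ball z s) g) \<le> ennreal (mean \<mu> (ball x r) g) + \<phi> y"
    using small_ball_majorant[OF g g0 osc N K r, where c=x] by blast
  define Q where "Q = {(z, t). r < t \<and> (\<exists>y. y \<in> ball x r \<and> y \<in> ball z t)}"
  define T where "T = (SUP (z, t)\<in>Q. mean \<mu> (ball z t) g)"
  have base: "(x, 2 * r) \<in> Q" using r by (auto simp: Q_def intro!: exI[of _ x])
  have Q_bound: "mean \<mu> (ball z t) g \<le> D ^ 3 * W" if zt: "(z, t) \<in> Q" for z t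
  proof -
    obtain y where t: "r < t" "dist x y < r" "dist z y < t" using zt by (auto simp: Q_def)
    then have "dist z x < 2 * t" using dist_triangle_less_add[of z y t x r] by (simp add: dist_commute)
    then have "mean \<mu> (ball z t) g \<le> D ^ 3 * mean \<mu> (ball x (3 * t)) g"
      by (intro mean_le_mean_superset[OF g g0]) (use t r in auto)
    also have "\<dots> \<le> D ^ 3 * W" by (intro mult_left_mono W) (use t r D in auto)
    finally show ?thesis .
  qed
  then have bdd: "bdd_above ((\<lambda>(z, t). mean \<mu> (ball z t) g) ` Q)"
    by (intro bdd_aboveI[of _ "D ^ 3 * W"]) auto
  have T_upper: "mean \<mu> (ball z t) g \<le> T" if "(z, t) \<in> Q" for z t
    unfolding T_def using cSUP_upper[OF that bdd] by simp
  have T_least: "T \<le> b" if "\<And>z t. (z, t) \<in> Q \<Longrightarrow> mean \<mu> (ball z t) g \<le> b" for b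
    unfolding T_def by (rule cSUP_least) (use base that in auto)
  have T0: "0 \<le> T" using order_trans[OF mean_nonneg[OF g0] T_upper[OF base]] .
  show thesis
  proof (rule that[OF T0 T_least[OF Q_bound] \<phi>(1,2)])
    fix y assume y: "y \<in> ball x r"
    show "?M y \<le> ennreal (T + D ^ 2 * N) + \<phi> y"
    proof (rule maximal_function_leI[OF g0])
      fix z s assume s: "0 < s" "y \<in> ball z s"
      show "ennreal (mean \<mu> (ball z s) g) \<le> ennreal (T + D ^ 2 * N) + \<phi> y"
      proof (cases "s \<le> r")
        case True
        have "mean \<mu> (ball x r) g \<le> mean \<mu> (ball x (2 * r)) g + D ^ 1 * N"
          using mean_diff_nested_le[OF g osc r, of x x "2 * r" 1] r by auto
        also have "\<dots> \<le> T + D ^ 2 * N"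
          by (intro add_mono T_upper base mult_right_mono power_increasing) (use D N in auto)
        finally have "ennreal (mean \<mu> (ball x r) g) \<le> ennreal (T + D ^ 2 * N)" by (rule ennreal_leI)
        then show ?thesis
          using \<phi>(3)[OF y s(1) True s(2)] by (meson add_right_mono order_trans)
      next
        case False
        then have "(z, s) \<in> Q" using y s by (auto simp: Q_def)
        then have "mean \<mu> (ball z s) g \<le> T" by (rule T_upper)
        moreover have "0 \<le> D ^ 2 * N" using D N by simp
        ultimately have "mean \<mu> (ball z s) g \<le> T + D ^ 2 * N" by linarith
        then show ?thesis by (rule add_increasing2[OF zero_le ennreal_leI])
      qed
    qed
    show "ennreal T \<le> ?M y + ennreal (D ^ 2 * N)"
    proof (cases "?M y")
      case (real m)
      have "T \<le> m + D ^ 2 * N"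
      proof (rule T_least)
        fix z t assume "(z, t) \<in> Q"
        then obtain y' where t: "r < t" "dist x y' < r" "dist z y' < t" by (auto simp: Q_def)
        have "dist z y \<le> dist z y' + dist y' x + dist x y"
          using dist_triangle[of z y y'] dist_triangle[of y' y x] by linarith
        then have "y \<in> ball z (t + 2 * r)" using t y by (simp add: dist_commute)
        then have "ennreal (mean \<mu> (ball z (t + 2 * r)) g) \<le> ennreal m"
          using mean_le_maximal_function[of g "t + 2 * r" y z] g0 t r real by simp
        then have "mean \<mu> (ball z (t + 2 * r)) g \<le> m" using real by simp
        moreover have "\<bar>mean \<mu> (ball z t) g - mean \<mu> (ball z (t + 2 * r)) g\<bar> \<le> D ^ 2 * N"
          by (rule mean_diff_nested_le[OF g osc]) (use t r in auto)
        ultimately show "mean \<mu> (ball z t) g \<le> m + D ^ 2 * N" by linarith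
      qed
      then show ?thesis using real N D by (simp add: ennreal_plus[symmetric] ennreal_leI del: ennreal_plus)
    qed simp
  qed
qed

text \<open>The same estimate for the real-valued maximal function: \<open>\<phi>\<close> is integrable, hence finite almost
  everywhere, and there the bounds from both sides become a bound for the distance to \<open>T\<close>.\<close>

lemma maximal_function_integrable_near_constant:
  fixes g :: "'a \<Rightarrow> real"
  assumes g: "locally_integrable \<mu> g" and g0: "\<And>y. 0 \<le> g y"
    and osc: "\<And>c r. 0 < r \<Longrightarrow> mean \<mu> (ball c r) (\<lambda>y. \<bar>g y - mean \<mu> (ball c r) g\<bar>) \<le> N"
    and N: "0 < N" and r: "0 < r"
    and W: "\<And>s. r \<le> s \<Longrightarrow> mean \<mu> (ball x s) g \<le> W"
  obtains T where "0 \<le> T" "T \<le> D ^ 3 * W"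
    "AE y in \<mu>. y \<in> ball x r \<longrightarrow> maximal_function \<mu> g y < \<infinity>"
    "set_integrable \<mu> (ball x r) (\<lambda>y. enn2real (maximal_function \<mu> g y))"
    "mean \<mu> (ball x r) (\<lambda>y. \<bar>enn2real (maximal_function \<mu> g y) - T\<bar>) \<le> 9 * D ^ 11 * N"
proof -
  note D = one_le_doubling_constant
  let ?B = "ball x r" let ?M = "maximal_function \<mu> g" let ?h = "\<lambda>y. enn2real (?M y)"
  define K where "K = 4 * D ^ 11 * N"
  have K0: "0 < K" using K_def N D by simp
  obtain T \<phi> where T: "0 \<le> T" "T \<le> D ^ 3 * W"
    and \<phi>[measurable]: "\<phi> \<in> borel_measurable \<mu>"
    and int_\<phi>: "(\<integral>\<^sup>+y. \<phi> y \<partial>\<mu>) \<le> ennreal (2 * K * measure \<mu> (ball x r))"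
    and upper: "\<And>y. y \<in> ?B \<Longrightarrow> ?M y \<le> ennreal (T + D ^ 2 * N) + \<phi> y"
    and lower: "\<And>y. y \<in> ?B \<Longrightarrow> ennreal T \<le> ?M y + ennreal (D ^ 2 * N)"
    using maximal_function_near_constant[OF g g0 osc N K_def r W] by blast
  have [measurable]: "?M \<in> borel_measurable \<mu>" by (rule borel_measurable_maximal_function)
  have "(\<integral>\<^sup>+y. \<phi> y \<partial>\<mu>) \<noteq> \<infinity>"
    using int_\<phi> by (auto simp: top_unique)
  then have finite: "AE y in \<mu>. \<phi> y \<noteq> \<infinity>" by (rule nn_integral_PInf_AE[OF \<phi>])
  have pointwise: "?M y < \<infinity> \<and> ennreal \<bar>?h y - T\<bar> \<le> ennreal (D ^ 2 * N) + \<phi> y"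
    if fin: "\<phi> y \<noteq> \<infinity>" and y: "y \<in> ?B" for y
  proof -
    obtain p where p: "\<phi> y = ennreal p" "0 \<le> p" using fin by (cases "\<phi> y") auto
    have M_le: "?M y \<le> ennreal (T + D ^ 2 * N + p)"
      using upper[OF y] p T N D by (simp add: ennreal_plus[symmetric] del: ennreal_plus)
    then obtain m where m: "?M y = ennreal m" "0 \<le> m" by (cases "?M y") (auto simp: top_unique)
    have "m \<le> T + D ^ 2 * N + p" 
      using M_le[unfolded m(1)] p T N D by (subst (asm) ennreal_le_iff) auto
    moreover have "T \<le> m + D ^ 2 * N"
      using lower[OF y] m N D by (simp add: ennreal_plus[symmetric] del: ennreal_plus)
    ultimately have "\<bar>?h y - T\<bar> \<le> D ^ 2 * N + p" using m p by simp
    then have "ennreal \<bar>?h y - T\<bar> \<le> ennreal (D ^ 2 * N + p)" by (rule ennreal_leI)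
    then show ?thesis using m p N D by (simp add: ennreal_plus[symmetric] del: ennreal_plus)
  qed
  have "(\<integral>\<^sup>+y. ennreal (norm (indicator ?B y *\<^sub>R \<bar>?h y - T\<bar>)) \<partial>\<mu>)
      \<le> (\<integral>\<^sup>+y. ennreal (D ^ 2 * N) * indicator ?B y + \<phi> y \<partial>\<mu>)"
    by (rule nn_integral_mono_AE, rule AE_mp[OF finite], rule AE_I2)
      (use pointwise in \<open>auto simp: indicator_def\<close>)
  also have "\<dots> = ennreal (D ^ 2 * N) * emeasure \<mu> ?B + (\<integral>\<^sup>+y. \<phi> y \<partial>\<mu>)"
    by (subst nn_integral_add) (auto simp: nn_integral_cmult_indicator)
  also have "\<dots> \<le> ennreal (D ^ 2 * N * measure \<mu> ?B) + ennreal (2 * K * measure \<mu> ?B)"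
    using N D by (intro add_mono int_\<phi>) (simp add: emeasure_ball_eq ennreal_mult)
  also have "\<dots> = ennreal ((D ^ 2 * N + 2 * K) * measure \<mu> ?B)"
    using N D K0 by (simp add: ennreal_plus[symmetric] algebra_simps del: ennreal_plus)
  also have "\<dots> \<le> ennreal (9 * D ^ 11 * N * measure \<mu> ?B)"
  proof (intro ennreal_leI mult_right_mono)
    have "D ^ 2 * N \<le> D ^ 11 * N"
      by (intro mult_right_mono power_increasing) (use D N in auto)
    then show "D ^ 2 * N + 2 * K \<le> 9 * D ^ 11 * N" by (simp add: K_def mult.commute)
  qed simp
  finally have bound: "(\<integral>\<^sup>+y. ennreal (norm (indicator ?B y *\<^sub>R \<bar>?h y - T\<bar>)) \<partial>\<mu>)
      \<le> ennreal (9 * D ^ 11 * N * measure \<mu> ?B)" .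
  have int: "set_integrable \<mu> ?B (\<lambda>y. \<bar>?h y - T\<bar>)"
    unfolding set_integrable_def
    by (rule integrableI_bounded) (use bound in \<open>auto intro: le_less_trans\<close>)
  have "ennreal (LINT y:?B|\<mu>. \<bar>?h y - T\<bar>) = (\<integral>\<^sup>+y. ennreal (norm (indicator ?B y *\<^sub>R \<bar>?h y - T\<bar>)) \<partial>\<mu>)"
    unfolding set_lebesgue_integral_def
    by (subst nn_integral_eq_integral[symmetric]) (use int in \<open>auto simp: set_integrable_def\<close>)
  with bound have "ennreal (LINT y:?B|\<mu>. \<bar>?h y - T\<bar>) \<le> ennreal (9 * D ^ 11 * N * measure \<mu> ?B)"
    by (simp only:)
  then have "(LINT y:?B|\<mu>. \<bar>?h y - T\<bar>) \<le> 9 * D ^ 11 * N * measure \<mu> ?B"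
    by (subst (asm) ennreal_le_iff) (use N D in auto)
  then have mean_bound: "mean \<mu> ?B (\<lambda>y. \<bar>?h y - T\<bar>) \<le> 9 * D ^ 11 * N"
    using measure_ball_pos[OF r, of x] unfolding set_integral_eq_mean[OF r] by (simp add: mult.commute)
  have "set_integrable \<mu> ?B (\<lambda>y. ?h y - T)"
    using int unfolding set_integrable_def
  proof (rule Bochner_Integration.integrable_bound)
    show "(\<lambda>y. indicator ?B y *\<^sub>R (?h y - T)) \<in> borel_measurable \<mu>" by measurable
  qed (auto simp: indicator_def)
  then have "set_integrable \<mu> ?B (\<lambda>y. (?h y - T) + T)"
    by (intro set_integral_add set_integrable_const)
  then have h: "set_integrable \<mu> ?B ?h" by simp
  have "AE y in \<mu>. y \<in> ?B \<longrightarrow> ?M y < \<infinity>"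
    using finite by (rule AE_mp) (use pointwise in auto)
  from that[OF T this h mean_bound] show thesis .
qed

section \<open>Boundedness on BMO\<close>

text \<open>On balls below the critical radius this is the oscillation condition for \<open>f\<close>; on the others the
  mean of \<open>norm f\<close> itself is at most \<open>A\<close>, which bounds the distance to the constant \<open>0\<close>.
  So one bound holds for all balls, irrespective of the critical radius. Positivity of the critical
  radius matters, because the condition at a point has no content if there are no radii below it.\<close>

lemma oscillation_norm_le:
  fixes f :: "'a \<Rightarrow> 'b::{banach, second_countable_topology}"
  assumes f: "locally_integrable \<mu> f" and bound: "BMO_bound \<mu> V f A"
    and \<rho>: "\<And>x. 0 < critical_radius \<mu> V x" and r: "0 < r"
  shows "mean \<mu> (ball c r) (\<lambda>y. \<bar>norm (f y) - mean \<mu> (ball c r) (\<lambda>y. norm (f y))\<bar>) \<le> 2 * A"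
proof -
  let ?B = "ball c r" let ?\<rho> = "critical_radius \<mu> V c"
  have *: "mean \<mu> ?B (\<lambda>y. \<bar>norm (f y) - mean \<mu> ?B (\<lambda>y. norm (f y))\<bar>)
      \<le> 2 * mean \<mu> ?B (\<lambda>y. \<bar>norm (f y) - a\<bar>)" for a
    using mean_oscillation_le[OF locally_integrable_norm[OF f] r, of c a] by simp
  show ?thesis
  proof (cases "r < ?\<rho>")
    case True
    let ?m = "mean \<mu> ?B f"
    have "mean \<mu> ?B (\<lambda>y. \<bar>norm (f y) - norm ?m\<bar>) \<le> mean \<mu> ?B (\<lambda>y. norm (f y - ?m))"
      using set_integrable_ball[OF locally_integrable_norm_diff[OF locally_integrable_norm[OF f]]]
        set_integrable_ball[OF locally_integrable_norm_diff[OF f]]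
      by (intro mean_mono) (auto simp: norm_triangle_ineq3)
    moreover have "mean \<mu> ?B (\<lambda>y. norm (f y - ?m)) \<le> A"
      using bound r True unfolding BMO_bound_def by blast
    ultimately show ?thesis using *[of "norm ?m"] by linarith
  next
    case False
    have "0 < ?\<rho> / 2 \<and> ?\<rho> / 2 < ?\<rho> \<and> ?\<rho> \<le> r" using \<rho>[of c] False by simp
    then have "mean \<mu> ?B (\<lambda>y. norm (f y)) \<le> A"
      using bound unfolding BMO_bound_def by blast
    then show ?thesis using *[of 0] by simp
  qed
qed

lemma mean_norm_le_of_BMO_bound:
  assumes "BMO_bound \<mu> V f A" "0 < critical_radius \<mu> V x" "critical_radius \<mu> V x \<le> r"
  shows "mean \<mu> (ball x r) (\<lambda>y. norm (f y)) \<le> A"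
proof -
  let ?\<rho> = "critical_radius \<mu> V x"
  have "0 < ?\<rho> / 2 \<and> ?\<rho> / 2 < ?\<rho> \<and> ?\<rho> \<le> r" using assms by simp
  then show ?thesis using assms(1) unfolding BMO_bound_def by blast
qed

text \<open>Below the critical radius, the maximal function is close to a constant \<open>T\<close> on the ball, which bounds
  its oscillation. From the critical radius on, all larger concentric balls have mean at most \<open>A\<close>, so
  \<open>T\<close> is bounded as well, and with it the mean of the maximal function. In the constant, \<open>9\<close> bounds
  the distance to \<open>T\<close>, and the two factors \<open>2\<close> come from \<open>N = 2 A\<close> and from the passage from \<open>T\<close> to the mean.\<close>

proposition BMO_bound_maximal_function:
  fixes f :: "'a \<Rightarrow> 'b::{banach, second_countable_topology}"
  assumes f: "locally_integrable \<mu> f" and bound: "BMO_bound \<mu> V f A" and A: "0 < A"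
    and \<rho>: "\<And>x. 0 < critical_radius \<mu> V x"
  shows "AE x in \<mu>. maximal_function \<mu> f x < \<infinity>"
    and "locally_integrable \<mu> (\<lambda>x. enn2real (maximal_function \<mu> f x))"
    and "BMO_bound \<mu> V (\<lambda>x. enn2real (maximal_function \<mu> f x)) (36 * D ^ 11 * A)"
proof -
  note D = one_le_doubling_constant
  define g where "g y = norm (f y)" for y
  have g: "locally_integrable \<mu> g" and g0: "\<And>y. 0 \<le> g y"
    using locally_integrable_norm[OF f] by (simp_all add: g_def[abs_def])
  have osc: "\<And>c r. 0 < r \<Longrightarrow> mean \<mu> (ball c r) (\<lambda>y. \<bar>g y - mean \<mu> (ball c r) g\<bar>) \<le> 2 * A"
    using oscillation_norm_le[OF f bound \<rho>] by (simp add: g_def[abs_def])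
  have N: "0 < 2 * A" using A by simp
  have large: "mean \<mu> (ball x r) g \<le> A" if "critical_radius \<mu> V x \<le> r" for x r
    using mean_norm_le_of_BMO_bound[OF bound \<rho> that] by (simp add: g_def[abs_def])
  have M_eq: "maximal_function \<mu> f = maximal_function \<mu> g"
    by (simp add: maximal_function_def fun_eq_iff g_def)
  let ?M = "maximal_function \<mu> g" let ?h = "\<lambda>y. enn2real (?M y)"
  (* The bound depends on x and r; it makes the constant T finite on every ball. *)
  have means_bounded: "\<exists>W. \<forall>s\<ge>r. mean \<mu> (ball x s) g \<le> W" if r: "0 < r" for x r
  proof -
    let ?\<rho> = "critical_radius \<mu> V x"
    obtain m where m: "?\<rho> / r < 2 ^ m" using real_arch_pow[of 2] by auto
    have "mean \<mu> (ball x s) g \<le> max A (D ^ m * mean \<mu> (ball x ?\<rho>) g)" if s: "r \<le> s" for s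
    proof (cases "?\<rho> \<le> s")
      case True
      then show ?thesis using large[of x s] by simp
    next
      case False
      have "?\<rho> \<le> 2 ^ m * r" using m r by (simp add: divide_less_eq)
      also have "\<dots> \<le> 2 ^ m * s" using s by simp
      finally have "mean \<mu> (ball x s) g \<le> D ^ m * mean \<mu> (ball x ?\<rho>) g"
        using False s r by (intro mean_le_mean_superset[OF g g0]) auto
      then show ?thesis by simp
    qed
    then show ?thesis by blast
  qed
  have local: "(AE y in \<mu>. y \<in> ball x r \<longrightarrow> ?M y < \<infinity>) \<and> set_integrable \<mu> (ball x r) ?h \<and>
      (\<exists>T. mean \<mu> (ball x r) (\<lambda>y. \<bar>?h y - T\<bar>) \<le> 9 * D ^ 11 * (2 * A))" if r: "0 < r" for x r
  proof -
    obtain W where W: "\<And>s. r \<le> s \<Longrightarrow> mean \<mu> (ball x s) g \<le> W" using means_bounded[OF r] by blast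
    show ?thesis
      by (rule maximal_function_integrable_near_constant[OF g g0 osc N r W]) auto
  qed
  have fin: "AE y in \<mu>. ?M y < \<infinity>"
  proof -
    have "AE y in \<mu>. \<forall>n. y \<in> ball 0 (Suc n) \<longrightarrow> ?M y < \<infinity>"
      unfolding AE_all_countable using local[of "real (Suc _)" 0] by (metis of_nat_0_less_iff zero_less_Suc)
    then show ?thesis
    proof (rule AE_mp, intro AE_I2 impI)
      fix y assume y: "\<forall>n. y \<in> ball 0 (Suc n) \<longrightarrow> ?M y < \<infinity>"
      obtain n where "norm y < real n" using reals_Archimedean2 by blast
      then have "y \<in> ball 0 (Suc n)" by simp
      then show "?M y < \<infinity>" using y by blast
    qed
  qed
  have h: "locally_integrable \<mu> ?h"
    unfolding locally_integrable_def
  proof (intro allI impI)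
    fix K :: "'a set" assume K: "compact K"
    then obtain r where r: "0 < r" "K \<subseteq> ball 0 r"
      using bounded_subset_ballD compact_imp_bounded by blast
    have "K \<in> sets \<mu>" using borel_sets K by (auto dest: compact_imp_closed borel_closed)
    then show "set_integrable \<mu> K ?h"
      using set_integrable_subset[of \<mu> "ball 0 r" ?h K] local[OF r(1)] r(2) by blast
  qed
  have "BMO_bound \<mu> V ?h (36 * D ^ 11 * A)"
    unfolding BMO_bound_def
  proof (intro conjI allI impI, goal_cases)
    case 1
    show ?case using A D by simp
  next
    case (2 x s r)
    then have s: "0 < s" by simp
    obtain T where "mean \<mu> (ball x s) (\<lambda>y. \<bar>?h y - T\<bar>) \<le> 9 * D ^ 11 * (2 * A)"
      using local[OF s] by blast
    then show ?case using mean_oscillation_le[OF h s, of x T] by simp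
  next
    case (3 x s r)
    then have r: "0 < r" by simp
    have W: "mean \<mu> (ball x t) g \<le> A" if "r \<le> t" for t
      using large that 3 by auto
    obtain T where T: "0 \<le> T" "T \<le> D ^ 3 * A"
      "mean \<mu> (ball x r) (\<lambda>y. \<bar>?h y - T\<bar>) \<le> 9 * D ^ 11 * (2 * A)"
      by (rule maximal_function_integrable_near_constant[OF g g0 osc N r W]) auto
    have "mean \<mu> (ball x r) (\<lambda>y. norm (?h y)) \<le> mean \<mu> (ball x r) (\<lambda>y. \<bar>?h y - T\<bar> + T)"
      using set_integrable_ball[OF locally_integrable_norm_diff[OF h]] T(1)
        set_integrable_ball[OF locally_integrable_norm[OF h]]
      by (intro mean_mono set_integral_add set_integrable_const) auto
    also have "\<dots> = mean \<mu> (ball x r) (\<lambda>y. \<bar>?h y - T\<bar>) + T"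
      using set_integrable_ball[OF locally_integrable_norm_diff[OF h]]
      by (simp add: mean_add set_integrable_const mean_const[OF r])
    also have "\<dots> \<le> 9 * D ^ 11 * (2 * A) + D ^ 3 * A" using T by simp
    also have "\<dots> \<le> 9 * D ^ 11 * (2 * A) + D ^ 11 * A"
      by (intro add_left_mono mult_right_mono power_increasing) (use A D in auto)
    also have "\<dots> \<le> 36 * D ^ 11 * A" using A D by simp
    finally show ?case .
  qed
  with fin h show "AE x in \<mu>. maximal_function \<mu> f x < \<infinity>"
    "locally_integrable \<mu> (\<lambda>x. enn2real (maximal_function \<mu> f x))"
    "BMO_bound \<mu> V (\<lambda>x. enn2real (maximal_function \<mu> f x)) (36 * D ^ 11 * A)"
    by (simp_all add: M_eq)
qed

text \<open>The bound was shown for positive \<open>A\<close> only; the case where \<open>0\<close> is an admissible bound follows by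
  letting \<open>A\<close> decrease to it.\<close>

theorem maximal_function_bounded_on_BMO:
  fixes f :: "'a \<Rightarrow> 'b::{banach, second_countable_topology}"
  assumes f: "f \<in> BMO \<mu> V" and \<rho>: "\<And>x. 0 < critical_radius \<mu> V x"
  shows "AE x in \<mu>. maximal_function \<mu> f x < \<infinity>"
    and "(\<lambda>x. enn2real (maximal_function \<mu> f x)) \<in> BMO \<mu> V"
    and "BMO_norm \<mu> V (\<lambda>x. enn2real (maximal_function \<mu> f x)) \<le> 36 * D ^ 11 * BMO_norm \<mu> V f"
proof -
  note D = one_le_doubling_constant
  let ?h = "\<lambda>x. enn2real (maximal_function \<mu> f x)"
  obtain A where f': "locally_integrable \<mu> f" and A: "BMO_bound \<mu> V f A"
    using f by (auto simp: BMO_def)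
  have enlarge: "BMO_bound \<mu> V f B'" if "BMO_bound \<mu> V f B" "B \<le> B'" for B B'
    using that unfolding BMO_bound_def by (meson order_trans)
  have A0: "0 \<le> A" using A by (simp add: BMO_bound_def)
  have h: "BMO_bound \<mu> V ?h (36 * D ^ 11 * B)" if "BMO_bound \<mu> V f B" "0 < B" for B
    by (rule BMO_bound_maximal_function(3)[OF f' that \<rho>])
  have A1: "BMO_bound \<mu> V f (A + 1)" "0 < A + 1" using enlarge[OF A] A0 by auto
  show "AE x in \<mu>. maximal_function \<mu> f x < \<infinity>"
    by (rule BMO_bound_maximal_function(1)[OF f' A1 \<rho>])
  show "?h \<in> BMO \<mu> V"
    unfolding BMO_def using BMO_bound_maximal_function(2)[OF f' A1 \<rho>] h[OF A1] by blast
  have "BMO_norm \<mu> V ?h \<le> 36 * D ^ 11 * B" if B: "BMO_bound \<mu> V f B" for B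
  proof (rule field_le_epsilon)
    fix e :: real assume e: "0 < e"
    define d where "d = e / (36 * D ^ 11)"
    have d: "0 < d" using e D by (simp add: d_def)
    have "0 \<le> B" using B by (simp add: BMO_bound_def)
    then have "BMO_bound \<mu> V ?h (36 * D ^ 11 * (B + d))"
      using enlarge[OF B] d by (intro h) auto
    then have "BMO_norm \<mu> V ?h \<le> 36 * D ^ 11 * (B + d)"
      unfolding BMO_norm_def
      by (intro cInf_lower) (auto intro!: bdd_belowI[of _ 0] simp: BMO_bound_def)
    also have "\<dots> = 36 * D ^ 11 * B + e" using D by (simp add: d_def algebra_simps)
    finally show "BMO_norm \<mu> V ?h \<le> 36 * D ^ 11 * B + e" .
  qed
  then have "BMO_norm \<mu> V ?h / (36 * D ^ 11) \<le> B" if "BMO_bound \<mu> V f B" for B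
    using that D by (simp add: divide_le_eq mult.commute)
  then have "BMO_norm \<mu> V ?h / (36 * D ^ 11) \<le> BMO_norm \<mu> V f"
    unfolding BMO_norm_def[of \<mu> V f] using A by (intro cInf_greatest) auto
  then show "BMO_norm \<mu> V ?h \<le> 36 * D ^ 11 * BMO_norm \<mu> V f"
    using D by (simp add: divide_le_eq mult.commute)
qed

section \<open>Positivity of the critical radius\<close>

text \<open>Jensen's inequality on the small ball, monotonicity of the integral of \<open>V\<^sup>q\<close>, and the reverse
  Hoelder inequality on the large ball give
  \<open>mean (ball x r) V \<le> K (R / r)\<^bsup>s / q\<^esup> mean (ball x R) V\<close>. If \<open>s < 2 q\<close> the exponent
  \<open>2 - s / q\<close> is positive, so the scale-invariant quantity \<open>r\<^sup>2 mean (ball x r) V\<close> is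
  subject to power growth in \<open>r\<close>.\<close>

lemma scaled_mean_growth:
  fixes V :: "'a \<Rightarrow> real"
  assumes growth: "\<And>x r R. 0 < r \<Longrightarrow> r \<le> R \<Longrightarrow>
      measure \<mu> (ball x R) \<le> C * (R / r) powr s * measure \<mu> (ball x r)"
    and C: "0 < C" and q: "1 < q" and V0: "AE x in \<mu>. 0 \<le> V x" and RH: "reverse_Hoelder \<mu> q V"
  obtains K where "0 < K"
    "\<And>x r R. 0 < r \<Longrightarrow> r \<le> R \<Longrightarrow>
      r\<^sup>2 * mean \<mu> (ball x r) V \<le> K * (r / R) powr (2 - s / q) * (R\<^sup>2 * mean \<mu> (ball x R) V)"
proof -
  have V: "locally_integrable \<mu> V" using RH by (simp add: reverse_Hoelder_def)
  obtain H where H: "0 < H"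
    and intq: "\<And>x r. 0 < r \<Longrightarrow> set_integrable \<mu> (ball x r) (\<lambda>y. V y powr q)"
    and rh: "\<And>x r. 0 < r \<Longrightarrow>
      mean \<mu> (ball x r) (\<lambda>y. V y powr q) powr (1 / q) \<le> H * mean \<mu> (ball x r) V"
    using RH by (auto simp: reverse_Hoelder_def)
  have nonneg: "0 \<le> mean \<mu> (ball x r) V" for x r
    by (rule mean_nonneg_AE[OF V0])
  let ?K = "C powr (1 / q) * H"
  show thesis
  proof (rule that)
    show "0 < ?K" using C H by simp
    fix x :: 'a and r R :: real assume r: "0 < r" "r \<le> R"
    then have R: "0 < R" by simp
    let ?F = "\<lambda>u. LINT y:ball x u|\<mu>. V y powr q"
    note pos = measure_ball_pos[OF r(1), of x] measure_ball_pos[OF R, of x]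
    have "?F r \<le> ?F R"
      using intq[OF r(1)] intq[OF R] ball_subset_ball_iff[of x r x R] r
      unfolding set_lebesgue_integral_def set_integrable_def
      by (intro integral_mono) (auto simp: indicator_def)
    then have "mean \<mu> (ball x r) (\<lambda>y. V y powr q) \<le> ?F R / measure \<mu> (ball x r)"
      using pos by (simp add: mean_def divide_inverse mult.commute mult_left_mono)
    also have "\<dots> = measure \<mu> (ball x R) / measure \<mu> (ball x r) * mean \<mu> (ball x R) (\<lambda>y. V y powr q)"
      using pos by (simp add: mean_def field_simps)
    also have "\<dots> \<le> C * (R / r) powr s * mean \<mu> (ball x R) (\<lambda>y. V y powr q)"
      by (intro mult_right_mono mean_nonneg) (use growth[OF r, of x] pos in \<open>auto simp: divide_le_eq\<close>)
    finally have "mean \<mu> (ball x r) V powr q \<le> C * (R / r) powr s * mean \<mu> (ball x R) (\<lambda>y. V y powr q)"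
      using powr_mean_le_mean_powr[OF q pos(1) ball_sets set_integrable_ball[OF V] intq[OF r(1)] V0]
      by (rule order_trans[rotated])
    then have "(mean \<mu> (ball x r) V powr q) powr (1 / q)
        \<le> (C * (R / r) powr s * mean \<mu> (ball x R) (\<lambda>y. V y powr q)) powr (1 / q)"
      using q by (intro powr_mono2) auto
    also have "\<dots> = C powr (1 / q) * (R / r) powr (s / q)
        * mean \<mu> (ball x R) (\<lambda>y. V y powr q) powr (1 / q)"
      using C r by (simp add: powr_mult powr_powr mean_nonneg)
    also have "\<dots> \<le> C powr (1 / q) * (R / r) powr (s / q) * (H * mean \<mu> (ball x R) V)"
      by (intro mult_left_mono rh R) auto
    finally have "mean \<mu> (ball x r) V \<le> ?K * (R / r) powr (s / q) * mean \<mu> (ball x R) V"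
      using q nonneg[of x r] by (simp add: powr_powr mult_ac)
    then have "r\<^sup>2 * mean \<mu> (ball x r) V \<le> r\<^sup>2 * (?K * (R / r) powr (s / q) * mean \<mu> (ball x R) V)"
      by (rule mult_left_mono) simp
    also have "\<dots> = ?K * ((R / r) powr (s / q) * (r / R)\<^sup>2) * (R\<^sup>2 * mean \<mu> (ball x R) V)"
      using R by (simp add: power_divide mult_ac)
    also have "(R / r) powr (s / q) * (r / R)\<^sup>2 = (r / R) powr (2 - s / q)"
    proof -
      have "(R / r) powr (s / q) = (r / R) powr (- (s / q))"
        using r R by (simp add: powr_minus powr_divide)
      moreover have "(r / R)\<^sup>2 = (r / R) powr 2"
        using r R by simp
      ultimately show ?thesis by (simp add: powr_add[symmetric])
    qed
    finally show "r\<^sup>2 * mean \<mu> (ball x r) V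
        \<le> ?K * (r / R) powr (2 - s / q) * (R\<^sup>2 * mean \<mu> (ball x R) V)" .
  qed
qed

text \<open>Let \<open>p r = r\<^sup>2 mean (ball x r) V\<close>. By the power growth, \<open>p\<close> tends to \<open>0\<close> at \<open>0\<close>, so that
  there are positive radii with \<open>p r \<le> 1\<close>; and \<open>p\<close> tends to infinity at infinity as soon as it is positive
  somewhere, so that these radii are bounded. Boundedness is essential, since the supremum of an
  unbounded set of reals is an unspecified value.\<close>

lemma critical_radius_pos:
  fixes V :: "'a \<Rightarrow> real"
  assumes growth: "\<And>x r R. 0 < r \<Longrightarrow> r \<le> R \<Longrightarrow>
      measure \<mu> (ball x R) \<le> C * (R / r) powr s * measure \<mu> (ball x r)"
    and C: "0 < C" and q: "1 < q" "s / 2 < q"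
    and V0: "AE x in \<mu>. 0 \<le> V x" and V1: "\<not> (AE x in \<mu>. V x = 0)" and RH: "reverse_Hoelder \<mu> q V"
  shows "0 < critical_radius \<mu> V x"
proof -
  define \<delta> where "\<delta> = 2 - s / q"
  have \<delta>: "0 < \<delta>" using q by (simp add: \<delta>_def field_simps)
  let ?p = "\<lambda>r. r\<^sup>2 * mean \<mu> (ball x r) V"
  obtain K where K: "0 < K" and scale: "\<And>r R. 0 < r \<Longrightarrow> r \<le> R \<Longrightarrow> ?p r \<le> K * (r / R) powr \<delta> * ?p R"
    using scaled_mean_growth[OF growth C q(1) V0 RH] unfolding \<delta>_def by metis
  have V: "locally_integrable \<mu> V" using RH by (simp add: reverse_Hoelder_def)
  have nonneg: "0 \<le> mean \<mu> (ball x r) V" for r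
    by (rule mean_nonneg_AE[OF V0])
  have "\<exists>r>0. 0 < ?p r"
  proof (rule ccontr)
    assume "\<not> ?thesis"
    then have zero: "mean \<mu> (ball x r) V = 0" if "0 < r" for r
      using nonneg[of r] that by (force simp: zero_less_mult_iff)
    have "AE y in \<mu>. y \<in> ball x (real (Suc n)) \<longrightarrow> V y = 0" for n
    proof -
      have "(LINT y:ball x (real (Suc n))|\<mu>. V y) = 0"
        by (subst set_integral_eq_mean) (simp_all add: zero)
      then have "AE y in \<mu>. indicator (ball x (real (Suc n))) y *\<^sub>R V y = 0"
        unfolding set_lebesgue_integral_def
        using set_integrable_ball[OF V, of x "real (Suc n)"] V0
        by (subst (asm) integral_nonneg_eq_0_iff_AE) (auto simp: set_integrable_def indicator_def)
      then show ?thesis by (rule AE_mp) (auto simp: indicator_def)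
    qed
    then have "AE y in \<mu>. \<forall>n. y \<in> ball x (real (Suc n)) \<longrightarrow> V y = 0"
      unfolding AE_all_countable by blast
    then have "AE y in \<mu>. V y = 0"
    proof (rule AE_mp, intro AE_I2 impI)
      fix y assume y: "\<forall>n. y \<in> ball x (real (Suc n)) \<longrightarrow> V y = 0"
      obtain n where "dist x y < real n" using reals_Archimedean2 by blast
      then have "y \<in> ball x (real (Suc n))" by simp
      then show "V y = 0" using y by blast
    qed
    then show False using V1 by simp
  qed
  then obtain r0 where r0: "0 < r0" "0 < ?p r0" by blast
  let ?S = "{r. 0 < r \<and> ?p r \<le> 1}"
  have "bdd_above ?S"
  proof (rule bdd_aboveI)
    define b where "b = r0 * (K / ?p r0) powr (1 / \<delta>)"
    fix R assume R: "R \<in> ?S"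
    show "R \<le> max r0 b"
    proof (cases "r0 \<le> R")
      case True
      have "?p r0 \<le> K * (r0 / R) powr \<delta> * 1"
        by (rule order_trans[OF scale[OF r0(1) True]]) (use R K in \<open>intro mult_left_mono, auto\<close>)
      also have "\<dots> = K / (R / r0) powr \<delta>"
        using r0 R by (simp add: powr_divide)
      finally have "(R / r0) powr \<delta> \<le> K / ?p r0"
        using r0 R by (simp add: field_simps)
      then have "((R / r0) powr \<delta>) powr (1 / \<delta>) \<le> (K / ?p r0) powr (1 / \<delta>)"
        using \<delta> by (intro powr_mono2) auto
      then have "R / r0 \<le> (K / ?p r0) powr (1 / \<delta>)"
        using \<delta> R r0 by (simp add: powr_powr)
      then have "R \<le> b" using r0 unfolding b_def by (simp add: divide_le_eq mult.commute)
      then show ?thesis by simp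
    qed simp
  qed
  moreover have "\<exists>r. r \<in> ?S"
  proof -
    define t where "t = min 1 ((1 / (K * ?p r0)) powr (1 / \<delta>))"
    have t: "0 < t" "t \<le> 1" using K r0 by (auto simp: t_def)
    have "t powr \<delta> \<le> ((1 / (K * ?p r0)) powr (1 / \<delta>)) powr \<delta>"
      using t \<delta> by (intro powr_mono2) (auto simp: t_def)
    also have "\<dots> = 1 / (K * ?p r0)" using \<delta> K r0 by (simp add: powr_powr)
    finally have "K * t powr \<delta> * ?p r0 \<le> 1"
      using K r0 by (simp add: pos_le_divide_eq mult_ac)
    moreover have "?p (t * r0) \<le> K * (t * r0 / r0) powr \<delta> * ?p r0"
      using t r0 by (intro scale) auto
    ultimately have "?p (t * r0) \<le> 1" using r0(1) by simp
    then show ?thesis using t r0 by (intro exI[of _ "t * r0"]) simp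
  qed
  ultimately show ?thesis
    unfolding critical_radius_def by (force intro: less_le_trans cSup_upper)
qed

end

section \<open>The Dunkl measure is doubling\<close>

text \<open>Every ball contains, in its concentric half, a point whose distance to all the hyperplanes orthogonal
  to elements of \<open>P\<close> is at least a fixed multiple of the radius. Move from \<open>x\<close> along \<open>b\<close>, which is
  transversal to all the hyperplanes: among \<open>card P + 1\<close> equally spaced points, each hyperplane is close to at most one, so some
  point is close to none.\<close>

lemma point_off_hyperplanes:
  fixes P :: "'a::euclidean_space set"
  assumes "finite P" and pos: "\<And>\<zeta>. \<zeta> \<in> P \<Longrightarrow> 0 < \<zeta> \<bullet> b"
  obtains \<epsilon> where "0 < \<epsilon>" "\<epsilon> \<le> 1"
    "\<And>x r. 0 < r \<Longrightarrow> \<exists>z. dist x z \<le> r / 2 \<and> (\<forall>\<zeta>\<in>P. \<epsilon> * r \<le> \<bar>\<zeta> \<bullet> z\<bar>)"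
proof (cases "P = {}")
  case True
  have "\<exists>z. dist x z \<le> r / 2" if "0 < r" for x :: 'a and r :: real
    by (rule exI[of _ x]) (use that in simp)
  then show thesis by (intro that[of 1]) (simp_all add: True)
next
  case False
  define M where "M = card P"
  define u where "u = sgn b"
  define \<beta> where "\<beta> = Min ((\<lambda>\<zeta>. \<zeta> \<bullet> u) ` P)"
  have "b \<noteq> 0" using False pos by force
  then have "0 < \<zeta> \<bullet> u" if "\<zeta> \<in> P" for \<zeta>
    using pos[OF that] by (simp add: u_def sgn_div_norm)
  then have \<beta>: "0 < \<beta>" using False assms(1) by (simp add: \<beta>_def)
  have \<beta>_le: "\<beta> \<le> \<zeta> \<bullet> u" if "\<zeta> \<in> P" for \<zeta>
    using that assms(1) by (simp add: \<beta>_def)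
  define \<delta> where "\<delta> = \<beta> / (2 * (M + 1))"
  have \<delta>: "0 < \<delta>" using \<beta> by (simp add: \<delta>_def)
  show thesis
  proof (rule that)
    show "0 < min 1 (\<delta> / 2)" "min 1 (\<delta> / 2) \<le> 1" using \<delta> by auto
    fix x :: 'a and r :: real assume r: "0 < r"
    define z where "z j = x + (real j * (r / (2 * (M + 1)))) *\<^sub>R u" for j :: nat
    have "\<exists>j\<le>M. \<forall>\<zeta>\<in>P. \<delta> / 2 * r \<le> \<bar>\<zeta> \<bullet> z j\<bar>"
    proof (rule ccontr)
      assume "\<not> ?thesis"
      then have "\<forall>j\<in>{..M}. \<exists>\<zeta>\<in>P. \<bar>\<zeta> \<bullet> z j\<bar> < \<delta> / 2 * r" by force
      then obtain F where F: "\<And>j. j \<le> M \<Longrightarrow> F j \<in> P \<and> \<bar>F j \<bullet> z j\<bar> < \<delta> / 2 * r"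
        unfolding bchoice_iff by (metis atMost_iff)
      have "\<not> inj_on F {..M}"
      proof
        assume "inj_on F {..M}"
        then have "card {..M} \<le> card P"
          by (rule card_inj_on_le) (use F assms(1) in auto)
        then show False by (simp add: M_def)
      qed
      then obtain i j where ij: "i \<le> M" "j \<le> M" "i < j" "F i = F j"
        unfolding inj_on_def by (metis atMost_iff linorder_neqE_nat)
      have "\<delta> * r = 1 * (r / (2 * (M + 1))) * \<beta>" by (simp add: \<delta>_def)
      also have "\<dots> \<le> (real j - real i) * (r / (2 * (M + 1))) * (F i \<bullet> u)"
        using ij r \<beta> \<beta>_le[of "F i"] F[of i] by (intro mult_mono) auto
      also have "\<dots> = F j \<bullet> z j - F i \<bullet> z i"
        by (simp add: z_def ij(4) algebra_simps diff_divide_distrib)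
      also have "\<dots> < \<delta> * r" using F[of i] F[of j] ij(1,2) by linarith
      finally show False by simp
    qed
    then obtain j where j: "j \<le> M" "\<And>\<zeta>. \<zeta> \<in> P \<Longrightarrow> \<delta> / 2 * r \<le> \<bar>\<zeta> \<bullet> z j\<bar>" by blast
    have "dist x (z j) = real j * (r / (2 * (M + 1)))"
      using r \<open>b \<noteq> 0\<close> by (simp add: z_def dist_norm u_def norm_sgn)
    also have "\<dots> \<le> real (M + 1) * (r / (2 * (M + 1)))"
      using j(1) r by (intro mult_right_mono) auto
    also have "\<dots> = r / 2" by (simp add: field_simps)
    finally have "dist x (z j) \<le> r / 2" .
    moreover have "min 1 (\<delta> / 2) * r \<le> \<bar>\<zeta> \<bullet> z j\<bar>" if "\<zeta> \<in> P" for \<zeta>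
      using j(2)[OF that] mult_right_mono[of "min 1 (\<delta> / 2)" "\<delta> / 2" r] r by linarith
    ultimately show "\<exists>z. dist x z \<le> r / 2 \<and> (\<forall>\<zeta>\<in>P. min 1 (\<delta> / 2) * r \<le> \<bar>\<zeta> \<bullet> z\<bar>)" by blast
  qed
qed

text \<open>The typical size of the Dunkl weight on \<open>ball x r\<close>. Where \<open>k\<close> vanishes the factor is \<open>1\<close>, as the
  base is positive for \<open>r > 0\<close>. The factor \<open>2\<close> is an upper bound for the length of the roots.\<close>

definition weight_scale :: "'a::euclidean_space set \<Rightarrow> 'a \<Rightarrow> ('a \<Rightarrow> real) \<Rightarrow> 'a \<Rightarrow> real \<Rightarrow> real" where
  "weight_scale R b k x r = (\<Prod>\<zeta>\<in>positive_roots R b. (\<bar>\<zeta> \<bullet> x\<bar> + 2 * r) powr (2 * k \<zeta>))"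

context
  fixes R :: "'a::euclidean_space set" and b :: 'a and k :: "'a \<Rightarrow> real"
  assumes root_system: "normalized_root_system R" and multiplicity: "multiplicity_function R k"
begin

lemma finite_positive_roots: "finite (positive_roots R b)"
  using root_system by (auto simp: normalized_root_system_def positive_roots_def)

lemma multiplicity_nonneg: "\<zeta> \<in> positive_roots R b \<Longrightarrow> 0 \<le> k \<zeta>"
  using multiplicity by (auto simp: multiplicity_function_def positive_roots_def)

lemma inner_root_diff_le:
  assumes "\<zeta> \<in> positive_roots R b" shows "\<bar>\<zeta> \<bullet> x\<bar> \<le> \<bar>\<zeta> \<bullet> y\<bar> + 2 * dist x y"
proof -
  have "\<zeta> \<in> R" using assms by (simp add: positive_roots_def)
  then have "(norm \<zeta>)\<^sup>2 = 2"
    using root_system unfolding normalized_root_system_def by blast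
  then have "norm \<zeta> \<le> 2" by (intro power2_le_imp_le[of "norm \<zeta>" 2]) simp_all
  have "\<bar>\<zeta> \<bullet> (x - y)\<bar> \<le> norm \<zeta> * norm (x - y)" by (rule Cauchy_Schwarz_ineq2)
  also have "\<dots> \<le> 2 * dist x y"
    using \<open>norm \<zeta> \<le> 2\<close> by (simp add: dist_norm mult_right_mono)
  finally show ?thesis by (simp add: inner_diff_right)
qed

lemma weight_scale_pos:
  assumes "0 < r" shows "0 < weight_scale R b k x r"
  unfolding weight_scale_def
proof (rule prod_pos)
  fix \<zeta>
  have "0 < \<bar>\<zeta> \<bullet> x\<bar> + 2 * r" using assms by (intro add_nonneg_pos) auto
  then show "0 < (\<bar>\<zeta> \<bullet> x\<bar> + 2 * r) powr (2 * k \<zeta>)" by simp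
qed

lemma dunkl_weight_measurable: "(\<lambda>x. ennreal (dunkl_weight R b k x)) \<in> borel_measurable lebesgue"
proof -
  have "(\<lambda>x. if k \<zeta> = 0 then 1 else \<bar>\<zeta> \<bullet> x\<bar> powr (2 * k \<zeta>)) \<in> borel_measurable borel" for \<zeta>
    by (cases "k \<zeta> = 0") auto
  then have "dunkl_weight R b k \<in> borel_measurable borel"
    unfolding dunkl_weight_def[abs_def] by (intro borel_measurable_prod) 
  then show ?thesis
    by (intro measurable_completion) simp
qed

lemma dunkl_weight_le_scale:
  assumes "y \<in> ball x r" shows "dunkl_weight R b k y \<le> weight_scale R b k x r"
  unfolding dunkl_weight_def weight_scale_def
proof (intro prod_mono conjI)
  fix \<zeta> assume \<zeta>: "\<zeta> \<in> positive_roots R b"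
  have "0 < r" using assms by (simp add: zero_le_dist[THEN le_less_trans])
  then have pos: "0 < \<bar>\<zeta> \<bullet> x\<bar> + 2 * r" by (intro add_nonneg_pos) auto
  have "\<bar>\<zeta> \<bullet> y\<bar> \<le> \<bar>\<zeta> \<bullet> x\<bar> + 2 * r"
    using inner_root_diff_le[OF \<zeta>, of y x] assms by (simp add: dist_commute)
  then show "(if k \<zeta> = 0 then 1 else \<bar>\<zeta> \<bullet> y\<bar> powr (2 * k \<zeta>)) \<le> (\<bar>\<zeta> \<bullet> x\<bar> + 2 * r) powr (2 * k \<zeta>)"
    using multiplicity_nonneg[OF \<zeta>] pos by (auto intro: powr_mono2)
qed auto

lemma prod_powr_multiplicity:
  assumes "0 < a" shows "(\<Prod>\<zeta>\<in>positive_roots R b. a powr (2 * k \<zeta>)) = a powr (2 * gamma_index R b k)"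
  using assms by (simp add: powr_sum[symmetric] gamma_index_def sum_distrib_left finite_positive_roots)

lemma weight_scale_growth:
  assumes "0 < r" "r \<le> s"
  shows "weight_scale R b k x s \<le> (s / r) powr (2 * gamma_index R b k) * weight_scale R b k x r"
proof -
  have sr: "1 \<le> s / r" using assms by simp
  have "weight_scale R b k x s \<le>
      (\<Prod>\<zeta>\<in>positive_roots R b. (s / r) powr (2 * k \<zeta>) * (\<bar>\<zeta> \<bullet> x\<bar> + 2 * r) powr (2 * k \<zeta>))"
    unfolding weight_scale_def
  proof (intro prod_mono conjI)
    fix \<zeta> assume \<zeta>: "\<zeta> \<in> positive_roots R b"
    have "\<bar>\<zeta> \<bullet> x\<bar> + 2 * s \<le> (s / r) * \<bar>\<zeta> \<bullet> x\<bar> + (s / r) * (2 * r)"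
      using mult_right_mono[OF sr abs_ge_zero[of "\<zeta> \<bullet> x"]] assms by simp
    also have "\<dots> = (s / r) * (\<bar>\<zeta> \<bullet> x\<bar> + 2 * r)" by (rule distrib_left[symmetric])
    finally have "(\<bar>\<zeta> \<bullet> x\<bar> + 2 * s) powr (2 * k \<zeta>) \<le> ((s / r) * (\<bar>\<zeta> \<bullet> x\<bar> + 2 * r)) powr (2 * k \<zeta>)"
      using multiplicity_nonneg[OF \<zeta>] assms by (intro powr_mono2) auto
    then show "(\<bar>\<zeta> \<bullet> x\<bar> + 2 * s) powr (2 * k \<zeta>)
        \<le> (s / r) powr (2 * k \<zeta>) * (\<bar>\<zeta> \<bullet> x\<bar> + 2 * r) powr (2 * k \<zeta>)"
      using assms by (simp only: powr_mult)
  qed auto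
  also have "\<dots> = (s / r) powr (2 * gamma_index R b k) * weight_scale R b k x r"
    using assms by (simp add: prod.distrib prod_powr_multiplicity weight_scale_def)
  finally show ?thesis .
qed

text \<open>On a small ball around a point far from all root hyperplanes, each \<open>\<bar>\<zeta> \<bullet> y\<bar>\<close> is at least a multiple of
  \<open>r\<close>, hence also at least a multiple of \<open>\<bar>\<zeta> \<bullet> x\<bar> + 2 r\<close>.\<close>

lemma dunkl_weight_ge_scale:
  obtains \<eta> c where "0 < \<eta>" "\<eta> \<le> 1 / 2" "0 < c"
    "\<And>x r. 0 < r \<Longrightarrow> \<exists>z. ball z (\<eta> * r) \<subseteq> ball x r \<and>
       (\<forall>y\<in>ball z (\<eta> * r). c * weight_scale R b k x r \<le> dunkl_weight R b k y)"
proof -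
  obtain \<epsilon> where \<epsilon>: "0 < \<epsilon>" "\<epsilon> \<le> 1" and off: "\<And>x r. 0 < r \<Longrightarrow>
      \<exists>z. dist x z \<le> r / 2 \<and> (\<forall>\<zeta>\<in>positive_roots R b. \<epsilon> * r \<le> \<bar>\<zeta> \<bullet> z\<bar>)"
    using point_off_hyperplanes[OF finite_positive_roots, of b] by (auto simp: positive_roots_def)
  define \<kappa> where "\<kappa> = 1 / (1 + 8 / \<epsilon>)"
  have \<kappa>: "0 < \<kappa>" using \<epsilon> by (simp add: \<kappa>_def add_pos_pos)
  show thesis
  proof (rule that)
    show "0 < \<epsilon> / 4" "\<epsilon> / 4 \<le> 1 / 2" using \<epsilon> by auto
    show "0 < \<kappa> powr (2 * gamma_index R b k)" using \<kappa> by simp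
    fix x :: 'a and r :: real assume r: "0 < r"
    then obtain z where z: "dist x z \<le> r / 2"
      "\<And>\<zeta>. \<zeta> \<in> positive_roots R b \<Longrightarrow> \<epsilon> * r \<le> \<bar>\<zeta> \<bullet> z\<bar>" using off by blast
    have er: "\<epsilon> / 4 * r \<le> r / 4" using mult_right_mono[of \<epsilon> 1 r] \<epsilon> r by simp
    have sub: "ball z (\<epsilon> / 4 * r) \<subseteq> ball x r"
      using z(1) er r unfolding ball_subset_ball_iff dist_commute[of z x] by linarith
    have "\<kappa> powr (2 * gamma_index R b k) * weight_scale R b k x r \<le> dunkl_weight R b k y"
      if y: "y \<in> ball z (\<epsilon> / 4 * r)" for y
    proof -
      have "\<kappa> powr (2 * gamma_index R b k) * weight_scale R b k x r =
        (\<Prod>\<zeta>\<in>positive_roots R b. \<kappa> powr (2 * k \<zeta>) * (\<bar>\<zeta> \<bullet> x\<bar> + 2 * r) powr (2 * k \<zeta>))"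
        by (simp add: prod.distrib prod_powr_multiplicity[OF \<kappa>] weight_scale_def)
      also have "\<dots> \<le> dunkl_weight R b k y"
        unfolding dunkl_weight_def
      proof (intro prod_mono conjI)
        fix \<zeta> assume \<zeta>: "\<zeta> \<in> positive_roots R b"
        have "\<epsilon> * r \<le> \<bar>\<zeta> \<bullet> y\<bar> + 2 * (\<epsilon> / 4 * r)"
          using z(2)[OF \<zeta>] inner_root_diff_le[OF \<zeta>, of z y] y by simp
        then have low: "\<epsilon> * r \<le> 2 * \<bar>\<zeta> \<bullet> y\<bar>" by simp
        have "dist x y < r" using sub y by auto
        then have "\<bar>\<zeta> \<bullet> x\<bar> + 2 * r \<le> \<bar>\<zeta> \<bullet> y\<bar> + 4 * r"
          using inner_root_diff_le[OF \<zeta>, of x y] by linarith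
        also have "\<dots> \<le> \<bar>\<zeta> \<bullet> y\<bar> + 4 * (2 * \<bar>\<zeta> \<bullet> y\<bar> / \<epsilon>)"
          using low \<epsilon> by (simp add: pos_le_divide_eq mult.commute)
        also have "\<dots> = \<bar>\<zeta> \<bullet> y\<bar> / \<kappa>"
          using \<epsilon> by (simp add: \<kappa>_def field_simps)
        finally have "\<kappa> * (\<bar>\<zeta> \<bullet> x\<bar> + 2 * r) \<le> \<bar>\<zeta> \<bullet> y\<bar>"
          using \<kappa> by (simp add: pos_le_divide_eq mult.commute)
        then have "(\<kappa> * (\<bar>\<zeta> \<bullet> x\<bar> + 2 * r)) powr (2 * k \<zeta>) \<le> \<bar>\<zeta> \<bullet> y\<bar> powr (2 * k \<zeta>)"
          using multiplicity_nonneg[OF \<zeta>] \<kappa> r by (intro powr_mono2) auto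
        moreover have "0 < \<bar>\<zeta> \<bullet> x\<bar> + 2 * r" using r by (intro add_nonneg_pos) auto
        ultimately show "\<kappa> powr (2 * k \<zeta>) * (\<bar>\<zeta> \<bullet> x\<bar> + 2 * r) powr (2 * k \<zeta>)
            \<le> (if k \<zeta> = 0 then 1 else \<bar>\<zeta> \<bullet> y\<bar> powr (2 * k \<zeta>))"
          using \<kappa> r by (auto simp: powr_mult)
      qed auto
      finally show ?thesis .
    qed
    with sub show "\<exists>z. ball z (\<epsilon> / 4 * r) \<subseteq> ball x r \<and>
       (\<forall>y\<in>ball z (\<epsilon> / 4 * r). \<kappa> powr (2 * gamma_index R b k) * weight_scale R b k x r \<le> dunkl_weight R b k y)"
      by blast
  qed
qed

text \<open>The measure of \<open>ball x r\<close> is comparable to \<open>r\<^sup>n\<close> times the scale of the weight, and that scale grows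
  at most like \<open>r\<close> to the power twice the index. The sharp exponent \<open>n + 2 \<gamma>\<close> is kept, because
  the hypothesis on the exponent of the potential is measured against it.\<close>

lemma dunkl_measure_growth:
  obtains C where "1 \<le> C"
    "\<And>x r. emeasure (dunkl_measure R b k) (ball x r) < \<infinity>"
    "\<And>x r. 0 < r \<Longrightarrow> 0 < measure (dunkl_measure R b k) (ball x r)"
    "\<And>x r s. 0 < r \<Longrightarrow> r \<le> s \<Longrightarrow> measure (dunkl_measure R b k) (ball x s) \<le>
       C * (s / r) powr (real DIM('a) + 2 * gamma_index R b k) * measure (dunkl_measure R b k) (ball x r)"
proof -
  let ?\<omega> = "dunkl_measure R b k" and ?w = "dunkl_weight R b k" and ?U = "weight_scale R b k"
    and ?\<gamma> = "gamma_index R b k"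
  define n where "n = DIM('a)"
  define v where "v = unit_ball_vol (real n)"
  have v: "0 < v" by (simp add: v_def)
  obtain \<eta> c where \<eta>: "0 < \<eta>" "\<eta> \<le> 1 / 2" and c: "0 < c"
    and low: "\<And>x r. 0 < r \<Longrightarrow> \<exists>z. ball z (\<eta> * r) \<subseteq> ball x r \<and>
       (\<forall>y\<in>ball z (\<eta> * r). c * ?U x r \<le> ?w y)"
    using dunkl_weight_ge_scale by blast
  have vol: "emeasure lborel (ball x r) = ennreal (v * r ^ n)" if "0 < r" for x :: 'a and r
    using emeasure_ball[of r x] that by (simp add: v_def n_def)
  have \<omega>: "emeasure ?\<omega> (ball x r) = (\<integral>\<^sup>+y. ennreal (?w y) * indicator (ball x r) y \<partial>lebesgue)" for x r
    unfolding dunkl_measure_def by (rule emeasure_density[OF dunkl_weight_measurable]) simp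
  have upper: "emeasure ?\<omega> (ball x r) \<le> ennreal (?U x r * (v * r ^ n))" if r: "0 < r" for x r
  proof -
    have "emeasure ?\<omega> (ball x r) \<le> (\<integral>\<^sup>+y. ennreal (?U x r) * indicator (ball x r) y \<partial>lebesgue)"
      unfolding \<omega> by (intro nn_integral_mono)
        (auto simp: indicator_def intro!: ennreal_leI dunkl_weight_le_scale)
    also have "\<dots> = ennreal (?U x r * (v * r ^ n))"
      using weight_scale_pos[OF r, of x] v r
      by (simp add: nn_integral_cmult_indicator vol ennreal_mult)
    finally show ?thesis .
  qed
  have fin: "emeasure ?\<omega> (ball x r) < \<infinity>" for x r
  proof (cases "0 < r")
    case True
    show ?thesis by (rule le_less_trans[OF upper[OF True]]) simp
  qed (simp add: ball_empty)
  have real: "emeasure ?\<omega> (ball x r) = ennreal (measure ?\<omega> (ball x r))" for x r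
    by (rule emeasure_eq_ennreal_measure) (use fin[of x r] in simp)
  have upper': "measure ?\<omega> (ball x r) \<le> ?U x r * (v * r ^ n)" if r: "0 < r" for x r
    using upper[OF r, of x] weight_scale_pos[OF r, of x] v r by (simp add: real ennreal_le_iff)
  have lower: "c * ?U x r * (v * (\<eta> * r) ^ n) \<le> measure ?\<omega> (ball x r)" if r: "0 < r" for x r
  proof -
    obtain z where z: "ball z (\<eta> * r) \<subseteq> ball x r" "\<And>y. y \<in> ball z (\<eta> * r) \<Longrightarrow> c * ?U x r \<le> ?w y"
      using low[OF r, of x] by blast
    have "ennreal (c * ?U x r * (v * (\<eta> * r) ^ n))
        = (\<integral>\<^sup>+y. ennreal (c * ?U x r) * indicator (ball z (\<eta> * r)) y \<partial>lebesgue)"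
      using weight_scale_pos[OF r, of x] v r c \<eta>
      by (simp add: nn_integral_cmult_indicator vol ennreal_mult)
    also have "\<dots> \<le> emeasure ?\<omega> (ball x r)"
      unfolding \<omega> using z by (intro nn_integral_mono) (auto simp: indicator_def intro!: ennreal_leI)
    finally show ?thesis by (simp add: real)
  qed
  have pos: "0 < measure ?\<omega> (ball x r)" if r: "0 < r" for x r
    by (rule less_le_trans[OF _ lower[OF r]])
      (use weight_scale_pos[OF r, of x] v r c \<eta> in auto)
  define C where "C = max 1 (1 / (c * \<eta> ^ n))"
  show thesis
  proof (rule that[OF _ fin pos])
    show "1 \<le> C" by (simp add: C_def)
    fix x :: 'a and r s :: real assume r: "0 < r" "r \<le> s"
    then have s: "0 < s" by simp
    have "measure ?\<omega> (ball x s) \<le> ?U x s * (v * s ^ n)" by (rule upper'[OF s])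
    also have "\<dots> \<le> ((s / r) powr (2 * ?\<gamma>) * ?U x r) * (v * s ^ n)"
      using v s by (intro mult_right_mono weight_scale_growth r) auto
    also have "\<dots> = (s / r) powr (2 * ?\<gamma>) * (s / r) ^ n * (1 / (c * \<eta> ^ n)) * (c * ?U x r * (v * (\<eta> * r) ^ n))"
      using c \<eta> r by (simp add: power_mult_distrib power_divide field_simps)
    also have "(s / r) powr (2 * ?\<gamma>) * (s / r) ^ n = (s / r) powr (real n + 2 * ?\<gamma>)"
      using r s by (simp add: powr_add powr_realpow)
    also have "(s / r) powr (real n + 2 * ?\<gamma>) * (1 / (c * \<eta> ^ n)) * (c * ?U x r * (v * (\<eta> * r) ^ n))
        \<le> (s / r) powr (real n + 2 * ?\<gamma>) * C * measure ?\<omega> (ball x r)"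
      by (intro mult_mono lower r mult_left_mono)
        (use weight_scale_pos[OF r(1), of x] v r c \<eta> in \<open>auto simp: C_def\<close>)
    finally show "measure ?\<omega> (ball x s) \<le>
       C * (s / r) powr (real DIM('a) + 2 * ?\<gamma>) * measure ?\<omega> (ball x r)"
      by (simp add: n_def mult_ac)
  qed
qed

end

section \<open>The maximal operator on BMO of the Schroedinger operator\<close>

theorem theorem5p4:
  fixes R :: "(real ^ 'n) set" and b :: "real ^ 'n" and k V :: "real ^ 'n \<Rightarrow> real" and q :: real
  defines "\<omega> \<equiv> dunkl_measure R b k"
  assumes "normalized_root_system R"
    and "\<forall>\<zeta>\<in>R. \<zeta> \<bullet> b \<noteq> 0"
    and "multiplicity_function R k"
    and "AE x in \<omega>. 0 \<le> V x"
    and "\<not> (AE x in \<omega>. V x = 0)"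
    and "q > max 1 ((real CARD('n) + 2 * gamma_index R b k) / 2)"
    and "reverse_Hoelder \<omega> q V"
  shows "\<exists>C>0. \<forall>f :: real ^ 'n \<Rightarrow> 'b::{real_normed_field, banach, second_countable_topology}.
    f \<in> BMO \<omega> V \<longrightarrow>
      (AE x in \<omega>. maximal_function \<omega> f x < \<infinity>) \<and>
      (\<lambda>x. enn2real (maximal_function \<omega> f x)) \<in> BMO \<omega> V \<and>
      BMO_norm \<omega> V (\<lambda>x. enn2real (maximal_function \<omega> f x)) \<le> C * BMO_norm \<omega> V f"
proof -
  let ?s = "real CARD('n) + 2 * gamma_index R b k"
  obtain C where C: "1 \<le> C"
    and finite: "\<And>x r. emeasure \<omega> (ball x r) < \<infinity>"
    and pos: "\<And>x r. 0 < r \<Longrightarrow> 0 < measure \<omega> (ball x r)"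
    and growth: "\<And>x r s. 0 < r \<Longrightarrow> r \<le> s \<Longrightarrow>
      measure \<omega> (ball x s) \<le> C * (s / r) powr ?s * measure \<omega> (ball x r)"
    using dunkl_measure_growth[OF assms(2,4), of b] unfolding \<omega>_def by auto
  define D where "D = C * 2 powr ?s"
  interpret doubling_measure \<omega> D
  proof
    show "sets borel \<subseteq> sets \<omega>" "space \<omega> = UNIV" by (auto simp: \<omega>_def dunkl_measure_def)
    show "measure \<omega> (ball x (2 * r)) \<le> D * measure \<omega> (ball x r)" if "0 < r" for x r
      using growth[of r "2 * r" x] that by (simp add: D_def)
  qed (fact finite pos)+
  have \<rho>: "0 < critical_radius \<omega> V x" for x
    by (rule critical_radius_pos[OF growth]) (use C assms(5-8) in auto)
  show ?thesis
    using maximal_function_bounded_on_BMO[OF _ \<rho>] one_le_doubling_constant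
    by (intro exI[of _ "36 * D ^ 11"]) auto
qed

end
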